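(* Let $Z \subset \R^d$ be a $d$-dimensional zonotope with lattice of flats $\mathcal{L} = \mathcal{L}(Z)$. If $\alpha$ is any cone angle, then \[ \check{\alpha}_i(Z) \ = \ W_{i}(\mathcal{L}(Z)) \quad \text{ and } \quad \widehat{\alpha}_i(Z) \ = \ (-1)^{d-i} w_{d-i}(\mathcal{L}(Z)^\mathrm{op}) \] for all $i=0,\dots,d-1$.
   Context: A cone angle is a map $\alpha$ from the set $\mathcal{C}_d$ of polyhedral cones in $\R^d$ with apex at the origin to $\R$ with $\alpha(\{0\})=0$, $\alpha(C\cup C') = \alpha(C)+\alpha(C')-\alpha(C\cap C')$ whenever $C\cup C', C\cap C' \in \mathcal{C}_d$, $\alpha(C)=0$ whenever $\dim C<d$, and $\alpha(\R^d)=1$. For a full-dimensional polytope $P$ and a face $F$, the interior angle is $\widehat{\alpha}(F,P) = \alpha(\mathrm{T}_F P)$, where $\mathrm{T}_F P = \mathrm{cone}(-q+P)$ for $q$ in the relative interior of $F$; the exterior angle is $\check{\alpha}(F,P) = \alpha(\mathrm{N}_F P + \mathsf{L}(F))$, where $\mathrm{N}_F P = \{c : \langle c,x\rangle \ge \langle c,y\rangle \text{ for all } x\in F, y \in P\}$ is the normal cone and $\mathsf{L}(F)$ is the linear subspace parallel to the affine hull of $F$. Then $\widehat{\alpha}_i(P)$ and $\check{\alpha}_i(P)$ are the sums of $\widehat{\alpha}(F,P)$, resp. $\check{\alpha}(F,P)$, over all $i$-dimensional faces $F$. The lattice of flats $\mathcal{L}(P) = \{\mathsf{L}(F) : \emptyset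 \neq F \subseteq P\}$ is ordered by inclusion (minimum $\{0\}$, maximum $\mathsf{L}(P)$); $\mathcal{L}^\mathrm{op}$ is the same set ordered by reverse inclusion. For a graded poset with minimum $\mathbf{0}$, $W_i$ is the number of elements of rank $i$ and $w_i = \sum_{a : \mathrm{rk}(a) = i} \mu(\mathbf{0},a)$, with $\mu$ the Möbius function. *)

theory Defs
  imports "HOL-Analysis.Analysis"
begin

section \<open>Posets\<close>

text \<open>
  A poset is given by its order relation \<^term>\<open>r\<close> (with \<^prop>\<open>Partial_order r\<close>); its ground set
  is \<^term>\<open>Field r\<close> and the opposite poset is \<^term>\<open>r\<inverse>\<close>.
\<close>

definition poset_bot :: "'b rel \<Rightarrow> 'b"
  where "poset_bot r = (THE z. z \<in> Field r \<and> (\<forall>a\<in>Field r. (z, a) \<in> r))"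

text \<open>
  The rank is the length (number of elements minus one) of a longest chain in the principal
  ideal below \<open>a\<close>. In a graded poset with minimum this is the common length of all maximal chains
  from the minimum to \<open>a\<close>; see the lemma \<open>poset_rank_eqI\<close>.
\<close>

definition poset_rank :: "'b rel \<Rightarrow> 'b \<Rightarrow> nat"
  where "poset_rank r a = Max ((\<lambda>C. card C - 1) ` {C \<in> Chains r. C \<subseteq> under r a})"

text \<open>
  The usual recursion for the Moebius function. The guard is needed only for termination; the
  value is the junk value 0 if \<open>r\<close> is not a finite partial order or \<open>(a, b)\<close> is not in \<open>r\<close>.
\<close>

function moebius :: "'b rel \<Rightarrow> 'b \<Rightarrow> 'b \<Rightarrow> int"
  where "moebius r a b =
    (if finite (Field r) \<and> Partial_order r \<and> (a, b) \<in> r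
     then if a = b then 1 else - (\<Sum>c\<in>{c. (a, c) \<in> r \<and> (c, b) \<in> r \<and> c \<noteq> b}. moebius r a c)
     else 0)"
  by pat_completeness auto
termination
proof (relation "Wellfounded.measure (\<lambda>(r, a, b). card (under r b))", goal_cases)
  case 1
  then show ?case by simp
next
  case (2 r a b c)
  then have po: "Partial_order r" and fin: "finite (Field r)"
    and cb: "(c, b) \<in> r" and ne: "c \<noteq> b"
    by auto
  have tr: "trans r" and an: "antisym r" and rf: "refl_on (Field r) r"
    using po by (auto simp: partial_order_on_def preorder_on_def)
  have "under r c \<subseteq> under r b"
    using tr cb by (auto simp: under_def dest: transD)
  moreover have "b \<in> under r b"
    using rf cb by (auto simp: under_def refl_on_def Field_def)
  moreover have "b \<notin> under r c"
    using an cb ne by (auto simp: under_def dest: antisymD)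
  ultimately have "under r c \<subset> under r b"
    by blast
  moreover have "finite (under r b)"
    by (rule finite_subset[OF _ fin]) (auto simp: under_def Field_def)
  ultimately show ?case
    by (simp add: psubset_card_mono)
qed

declare moebius.simps [simp del]

definition whitney_second :: "'b rel \<Rightarrow> nat \<Rightarrow> nat"
  where "whitney_second r i = card {a \<in> Field r. poset_rank r a = i}"

definition whitney_first :: "'b rel \<Rightarrow> nat \<Rightarrow> int"
  where "whitney_first r i = (\<Sum>a\<in>{a \<in> Field r. poset_rank r a = i}. moebius r (poset_bot r) a)"

lemma poset_rank_eqI:
  fixes r :: "'b rel" and n :: nat
  assumes fin: "finite (Field r)" and po: "Partial_order r" and a: "a \<in> Field r"
    and graded: "\<And>C. \<lbrakk>C \<in> Chains r; C \<subseteq> under r a;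
        \<And>D. \<lbrakk>D \<in> Chains r; D \<subseteq> under r a; C \<subseteq> D\<rbrakk> \<Longrightarrow> D = C\<rbrakk> \<Longrightarrow> card C = Suc n"
  shows "poset_rank r a = n"
proof -
  let ?S = "{C \<in> Chains r. C \<subseteq> under r a}"
  have finu: "finite (under r a)"
    by (rule finite_subset[OF _ fin]) (auto simp: under_def Field_def)
  then have finS: "finite ?S"
    by (auto intro: finite_subset[of _ "Pow (under r a)"])
  have max: "\<exists>M\<in>?S. C \<subseteq> M \<and> (\<forall>D\<in>?S. M \<subseteq> D \<longrightarrow> D = M)" if C: "C \<in> ?S" for C
  proof -
    obtain M where "M \<in> ?S" "C \<subseteq> M" "\<forall>D\<in>?S. M \<subseteq> D \<longrightarrow> M = D"
      using finite_has_maximal2[OF finS C] by (elim bexE conjE)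
    then show ?thesis
      by (intro bexI[of _ M]) auto
  qed
  have card_max: "card M = Suc n" if "M \<in> ?S" "\<forall>D\<in>?S. M \<subseteq> D \<longrightarrow> D = M" for M
    using graded[of M] that by auto
  have "card C - 1 \<le> n" if C: "C \<in> ?S" for C
  proof -
    obtain M where M: "M \<in> ?S" "C \<subseteq> M" "\<forall>D\<in>?S. M \<subseteq> D \<longrightarrow> D = M"
      using max[OF C] by blast
    have "card C \<le> card M"
      using M finu by (intro card_mono) (auto intro: finite_subset)
    then show ?thesis
      using card_max[OF M(1,3)] by simp
  qed
  moreover have "n \<in> (\<lambda>C. card C - 1) ` ?S"
  proof -
    have "{} \<in> ?S"
      by (simp add: Chains_def)
    then obtain M where M: "M \<in> ?S" "\<forall>D\<in>?S. M \<subseteq> D \<longrightarrow> D = M"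
      using max by blast
    have "n = card M - 1"
      using card_max[OF M] by simp
    then show ?thesis
      using M(1) by (rule image_eqI)
  qed
  ultimately show ?thesis
    unfolding poset_rank_def using finS by (intro Max_eqI) auto
qed


section \<open>Cone angles\<close>

definition polyhedral_cone :: "'a::euclidean_space set \<Rightarrow> bool"
  where "polyhedral_cone C \<longleftrightarrow> polyhedron C \<and> convex_cone C"

definition cone_angle :: "('a::euclidean_space set \<Rightarrow> real) \<Rightarrow> bool"
  where "cone_angle \<alpha> \<longleftrightarrow>
    \<alpha> {0} = 0 \<and>
    (\<forall>C C'. polyhedral_cone C \<and> polyhedral_cone C' \<and>
        polyhedral_cone (C \<union> C') \<and> polyhedral_cone (C \<inter> C') \<longrightarrow>
        \<alpha> (C \<union> C') = \<alpha> C + \<alpha> C' - \<alpha> (C \<inter> C')) \<and>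
    (\<forall>C. polyhedral_cone C \<and> aff_dim C < int DIM('a) \<longrightarrow> \<alpha> C = 0) \<and>
    \<alpha> UNIV = 1"


section \<open>Interior and exterior angles of polytopes\<close>

definition tangent_cone :: "'a::euclidean_space set \<Rightarrow> 'a set \<Rightarrow> 'a set"
  where "tangent_cone F P =
    (let q = SOME q. q \<in> rel_interior F in convex_cone hull ((\<lambda>x. - q + x) ` P))"

definition normal_cone :: "'a::euclidean_space set \<Rightarrow> 'a set \<Rightarrow> 'a set"
  where "normal_cone F P = {c. \<forall>x\<in>F. \<forall>y\<in>P. c \<bullet> x \<ge> c \<bullet> y}"

definition lin_space :: "'a::euclidean_space set \<Rightarrow> 'a set"
  where "lin_space F = {x - y | x y. x \<in> affine hull F \<and> y \<in> affine hull F}"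

definition interior_angle :: "('a::euclidean_space set \<Rightarrow> real) \<Rightarrow> 'a set \<Rightarrow> 'a set \<Rightarrow> real"
  where "interior_angle \<alpha> F P = \<alpha> (tangent_cone F P)"

text \<open>The sum of sets below is the Minkowski sum.\<close>

definition exterior_angle :: "('a::euclidean_space set \<Rightarrow> real) \<Rightarrow> 'a set \<Rightarrow> 'a set \<Rightarrow> real"
  where "exterior_angle \<alpha> F P = \<alpha> (normal_cone F P + lin_space F)"

definition interior_angle_sum :: "('a::euclidean_space set \<Rightarrow> real) \<Rightarrow> nat \<Rightarrow> 'a set \<Rightarrow> real"
  where "interior_angle_sum \<alpha> i P =
    (\<Sum>F\<in>{F. F face_of P \<and> aff_dim F = int i}. interior_angle \<alpha> F P)"

definition exterior_angle_sum :: "('a::euclidean_space set \<Rightarrow> real) \<Rightarrow> nat \<Rightarrow> 'a set \<Rightarrow> real"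
  where "exterior_angle_sum \<alpha> i P =
    (\<Sum>F\<in>{F. F face_of P \<and> aff_dim F = int i}. exterior_angle \<alpha> F P)"

lemma lin_space_parallel:
  fixes F :: "'a::euclidean_space set"
  assumes "F \<noteq> {}"
  shows "subspace (lin_space F)" and "affine_parallel (affine hull F) (lin_space F)"
proof -
  obtain a where a: "a \<in> affine hull F"
    using assms hull_subset by fastforce
  have sub: "subspace ((\<lambda>x. x - a) ` (affine hull F))"
    using a by (simp add: affine_diffs_subspace_subtract)
  have eq: "lin_space F = (\<lambda>x. x - a) ` (affine hull F)"
  proof
    show "lin_space F \<subseteq> (\<lambda>x. x - a) ` (affine hull F)"
    proof
      fix z assume "z \<in> lin_space F"
      then obtain x y where xy: "x \<in> affine hull F" "y \<in> affine hull F" "z = x - y"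
        by (auto simp: lin_space_def)
      have "(x - a) - (y - a) \<in> (\<lambda>x. x - a) ` (affine hull F)"
        using subspace_diff[OF sub] xy by blast
      then show "z \<in> (\<lambda>x. x - a) ` (affine hull F)"
        using xy by simp
    qed
  qed (use a in \<open>auto simp: lin_space_def\<close>)
  show "subspace (lin_space F)"
    using sub eq by simp
  show "affine_parallel (affine hull F) (lin_space F)"
    unfolding affine_parallel_def eq by (intro exI[of _ "- a"]) simp
qed

lemma convex_cone_hull_translate_le:
  fixes F P :: "'a::euclidean_space set"
  assumes "F \<subseteq> P" "convex F" "q \<in> rel_interior F" "p \<in> F"
  shows "convex_cone hull ((\<lambda>x. - p + x) ` P) \<subseteq> convex_cone hull ((\<lambda>x. - q + x) ` P)"
    (is "_ \<subseteq> ?K")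
proof (rule hull_minimal)
  have K: "convex_cone ?K"
    by (rule convex_cone_convex_cone_hull)
  have in_K: "- q + y \<in> ?K" if "y \<in> P" for y
    using that by (simp add: hull_inc)
  obtain e where e: "e > 1" "(1 - e) *\<^sub>R p + e *\<^sub>R q \<in> F"
    using convex_rel_interior_iff[of F q] assms by blast
  have "- q + ((1 - e) *\<^sub>R p + e *\<^sub>R q) \<in> ?K"
    using e assms in_K by blast
  then have "(1 / (e - 1)) *\<^sub>R (- q + ((1 - e) *\<^sub>R p + e *\<^sub>R q)) \<in> ?K"
    using K e by (intro convex_cone_scaleR) auto
  moreover have "- q + ((1 - e) *\<^sub>R p + e *\<^sub>R q) = (e - 1) *\<^sub>R (q - p)"
    by (simp add: algebra_simps)
  ultimately have "q - p \<in> ?K"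
    using e by simp
  then have "(- q + y) + (q - p) \<in> ?K" if "y \<in> P" for y
    using convex_cone_add[OF K in_K[OF that]] by blast
  moreover have "(- q + y) + (q - p) = - p + y" for y
    by simp
  ultimately have "- p + y \<in> ?K" if "y \<in> P" for y
    using that by metis
  then show "(\<lambda>x. - p + x) ` P \<subseteq> ?K"
    by blast
  show "convex_cone ?K"
    by (rule K)
qed

lemma tangent_cone_eq:
  fixes F P :: "'a::euclidean_space set"
  assumes "F \<subseteq> P" "convex F" "q \<in> rel_interior F"
  shows "tangent_cone F P = convex_cone hull ((\<lambda>x. - q + x) ` P)"
proof -
  let ?p = "SOME p. p \<in> rel_interior F"
  have p: "?p \<in> rel_interior F"
    using assms(3) by (rule someI)
  have "?p \<in> F" "q \<in> F"
    using p assms(3) rel_interior_subset by blast+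
  then show ?thesis
    unfolding tangent_cone_def Let_def using assms p
    by (intro subset_antisym convex_cone_hull_translate_le)
qed


section \<open>Zonotopes and the lattice of flats\<close>

definition zonotope :: "'a::euclidean_space set \<Rightarrow> bool"
  where "zonotope Z \<longleftrightarrow> (\<exists>(m::nat) a b. Z = (\<Sum>k<m. closed_segment (a k) (b k)))"

definition flats :: "'a::euclidean_space set \<Rightarrow> 'a set set"
  where "flats P = {lin_space F | F. F face_of P \<and> F \<noteq> {}}"

definition lattice_of_flats :: "'a::euclidean_space set \<Rightarrow> 'a set rel"
  where "lattice_of_flats P = {(U, V). U \<in> flats P \<and> V \<in> flats P \<and> U \<subseteq> V}"

end

theory Submission
  imports Defs
begin

text \<open>
  A cone angle is additive under cutting by hyperplanes and ignores lower-dimensional cones, so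
  every linear relation between indicator functions of polyhedral cones that holds off finitely
  many hyperplanes also holds between their angles.

  The faces of a zonotope correspond to the cells of the hyperplane arrangement of its generators:
  \<open>c\<close> lies in the cell of \<open>F\<close> iff \<open>F\<close> is the face on which \<open>c\<close> is maximal, and \<open>L(F)\<close> is spanned
  by the generators orthogonal to the cell. For a fixed flat \<open>U\<close>, the cones \<open>N_F + U\<close> with
  \<open>L(F) = U\<close> tile the space, so their angles add up to 1.

  The tangent cone of \<open>F\<close> consists of those \<open>x\<close> that are nonpositive on the cell of \<open>F\<close>. For a
  flat \<open>U\<close> other than the whole space and generic \<open>x\<close>, decompose the closed half-space of
  \<open>U\<close>-orthogonal vectors \<open>c\<close> with \<open>x \<bullet> c \<le> 0\<close>, whose Euler characteristic with compact supports
  is 0, along the arrangement: cells that meet both sides of the hyperplane contribute 0, and the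
  others show that the signed number of \<open>F\<close> with \<open>U \<subseteq> L(F)\<close> and \<open>x \<in> T_F\<close> is 0. This is the
  recursion of the Moebius function of the opposite lattice of flats.
\<close>

section \<open>Cone angles as simple valuations\<close>

text \<open>Scaling the points of the cone shows that each defining inequality still holds on it
  with bound 0. Since \<open>0 \<in> C\<close>, the original bounds are nonnegative, so the
  homogeneous system implies the original one. The normals stay nonzero so that each defines a
  genuine hyperplane to cut along.\<close>

lemma polyhedral_cone_halfspaces:
  fixes C :: "'a::euclidean_space set"
  assumes "polyhedral_cone C"
  obtains N where "finite N" "0 \<notin> N" "C = {x. \<forall>a\<in>N. a \<bullet> x \<le> 0}"
proof -
  from assms have "polyhedron C" and cone: "convex_cone C"
    by (auto simp: polyhedral_cone_def)
  then obtain H where H: "finite H" "C = \<Inter>H" "\<forall>h\<in>H. \<exists>a b. a \<noteq> 0 \<and> h = {x. a \<bullet> x \<le> b}"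
    unfolding polyhedron_def by blast
  then obtain a b where ab: "\<forall>h\<in>H. a h \<noteq> 0 \<and> h = {x. a h \<bullet> x \<le> b h}"
    by metis
  then have nz: "0 \<notin> a ` H"
    by (metis imageE)
  have mem: "x \<in> C \<longleftrightarrow> (\<forall>h\<in>H. a h \<bullet> x \<le> b h)" for x
    unfolding H(2) using ab by blast
  have "a h \<bullet> x \<le> 0" if "x \<in> C" "h \<in> H" for x h
  proof (rule ccontr)
    assume "\<not> a h \<bullet> x \<le> 0"
    then have pos: "a h \<bullet> x > 0" by simp
    \<comment> \<open>This scale gives
      \<open>a h \<bullet> (t *\<^sub>R x) = \<bar>b h\<bar> + 1\<close>, which exceeds
      \<open>b h\<close>.\<close>
    define t where "t = (\<bar>b h\<bar> + 1) / (a h \<bullet> x)"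
    have "t *\<^sub>R x \<in> C"
      using cone that pos by (intro convex_cone_scaleR) (auto simp: t_def)
    then have "a h \<bullet> (t *\<^sub>R x) \<le> b h"
      using that(2) mem by blast
    then show False
      using pos by (simp add: t_def)
  qed
  moreover have "x \<in> C" if "\<forall>h\<in>H. a h \<bullet> x \<le> 0" for x
  proof -
    have "0 \<in> C"
      using cone by (simp add: convex_cone_contains_0)
    then have "0 \<le> b h" if "h \<in> H" for h
      using mem[of 0] that by simp
    then show ?thesis
      unfolding mem using that by (meson order_trans)
  qed
  ultimately have "C = {x. \<forall>v\<in>a ` H. v \<bullet> x \<le> 0}"
    by auto
  with H(1) nz show thesis
    by (intro that[of "a ` H"]) auto
qed

lemma polyhedral_cone_halfspace_le: "polyhedral_cone {x. a \<bullet> x \<le> 0}"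
  and polyhedral_cone_halfspace_ge: "polyhedral_cone {x. a \<bullet> x \<ge> 0}"
  for a :: "'a::euclidean_space"
  by (auto simp: polyhedral_cone_def polyhedron_halfspace_le polyhedron_halfspace_ge convex_cone_iff
      inner_add_right mult_nonneg_nonpos)

lemma polyhedral_cone_UNIV: "polyhedral_cone UNIV"
  by (auto simp: polyhedral_cone_def convex_cone_iff)

lemma polyhedral_cone_Int:
  "polyhedral_cone C \<Longrightarrow> polyhedral_cone D \<Longrightarrow> polyhedral_cone (C \<inter> D)"
  by (auto simp: polyhedral_cone_def convex_cone_iff)

lemma polyhedral_cone_INT:
  assumes "finite I" "\<And>i. i \<in> I \<Longrightarrow> polyhedral_cone (C i)"
  shows "polyhedral_cone (\<Inter>i\<in>I. C i)"
  using assms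
  by (induction I rule: finite_induct) (auto simp: polyhedral_cone_UNIV polyhedral_cone_Int)

lemma cone_angle_low_dim:
  fixes \<alpha> :: "'a::euclidean_space set \<Rightarrow> real"
  assumes "cone_angle \<alpha>" "polyhedral_cone C" "C \<subseteq> {x. a \<bullet> x = 0}" "a \<noteq> 0"
  shows "\<alpha> C = 0"
proof -
  have "aff_dim C \<le> aff_dim {x. a \<bullet> x = 0}"
    using assms(3) by (rule aff_dim_subset)
  also have "\<dots> < int DIM('a)"
    using assms(4) by (simp add: aff_dim_hyperplane)
  finally show ?thesis
    using assms by (auto simp: cone_angle_def)
qed

text \<open>The two halves overlap inside a hyperplane, where a cone angle vanishes, so
  inclusion-exclusion loses its last term.\<close>

lemma cone_angle_split:
  fixes \<alpha> :: "'a::euclidean_space set \<Rightarrow> real"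
  assumes \<alpha>: "cone_angle \<alpha>" and C: "polyhedral_cone C" and "a \<noteq> 0"
  shows "\<alpha> C = \<alpha> (C \<inter> {x. a \<bullet> x \<le> 0}) + \<alpha> (C \<inter> {x. a \<bullet> x \<ge> 0})"
proof -
  let ?L = "C \<inter> {x. a \<bullet> x \<le> 0}" and ?R = "C \<inter> {x. a \<bullet> x \<ge> 0}"
  have poly: "polyhedral_cone ?L" "polyhedral_cone ?R"
    by (simp_all add: C polyhedral_cone_Int polyhedral_cone_halfspace_le
        polyhedral_cone_halfspace_ge)
  have un: "?L \<union> ?R = C" by auto
  have "polyhedral_cone (?L \<union> ?R)"
    unfolding un by (rule C)
  then have "\<alpha> (?L \<union> ?R) = \<alpha> ?L + \<alpha> ?R - \<alpha> (?L \<inter> ?R)"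
    using \<alpha> poly polyhedral_cone_Int[OF poly] unfolding cone_angle_def
    by (elim conjE allE[of _ ?L] allE[of _ ?R]) simp
  moreover have "\<alpha> (?L \<inter> ?R) = 0"
    by (rule cone_angle_low_dim[OF \<alpha> polyhedral_cone_Int[OF poly] _ \<open>a \<noteq> 0\<close>]) auto
  ultimately show ?thesis
    using un by simp
qed

text \<open>A finite union of hyperplanes has measure zero, a nonempty open set has not. This is the
  source of generic points.\<close>

lemma open_avoids_hyperplanes:
  fixes S :: "'a::euclidean_space set"
  assumes "open S" "S \<noteq> {}" "finite B" "0 \<notin> B"
  obtains x where "x \<in> S" "\<forall>b\<in>B. b \<bullet> x \<noteq> 0"
proof -
  have "negligible (\<Union>b\<in>B. {x. b \<bullet> x = 0})"
    using assms by (intro negligible_Union) (auto intro!: negligible_hyperplane)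
  then have "\<not> S \<subseteq> (\<Union>b\<in>B. {x. b \<bullet> x = 0})"
    using open_not_negligible[OF assms(1,2)] negligible_subset by blast
  then show thesis
    using that by blast
qed

text \<open>
  Cutting along all the hyperplanes that occur reduces the identity to cones that lie on one
  side of each of them; on the interior of such a cone every indicator function is constant.
\<close>

lemma cone_angle_indicator_identity:
  fixes \<alpha> :: "'a::euclidean_space set \<Rightarrow> real" and w :: "'i \<Rightarrow> real"
  assumes \<alpha>: "cone_angle \<alpha>" and fin: "finite I"
    and C: "\<And>i. i \<in> I \<Longrightarrow> polyhedral_cone (C i)"
    and B: "finite B" "0 \<notin> B"
    and ind: "\<And>x. \<forall>b\<in>B. b \<bullet> x \<noteq> 0 \<Longrightarrow> (\<Sum>i\<in>I. w i * indicator (C i) x) = n"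
  shows "(\<Sum>i\<in>I. w i * \<alpha> (C i)) = n"
proof -
  have "\<exists>N. finite N \<and> 0 \<notin> N \<and> C i = {x. \<forall>a\<in>N. a \<bullet> x \<le> 0}" if "i \<in> I" for i
    by (rule polyhedral_cone_halfspaces[OF C[OF that]]) (intro exI conjI)
  then have "\<forall>i\<in>I. \<exists>N. finite N \<and> 0 \<notin> N \<and> C i = {x. \<forall>a\<in>N. a \<bullet> x \<le> 0}" ..
  then obtain N where "\<forall>i\<in>I. finite (N i) \<and> 0 \<notin> N i \<and> C i = {x. \<forall>a\<in>N i. a \<bullet> x \<le> 0}"
    by (rule bchoice[THEN exE])
  then have N: "finite (N i) \<and> 0 \<notin> N i \<and> C i = {x. \<forall>a\<in>N i. a \<bullet> x \<le> 0}" if "i \<in> I" for i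
    using that by (rule bspec)
  define A where "A = B \<union> (\<Union>i\<in>I. N i)"
  have A: "finite A" "0 \<notin> A"
    using fin N B by (auto simp: A_def)
  \<comment> \<open>\<open>M\<close> holds the hyperplanes along which \<open>D\<close> may still
    have to be cut; each of the others in \<open>A\<close> already has \<open>D\<close> on one
    side.\<close>
  have "(\<Sum>i\<in>I. w i * \<alpha> (C i \<inter> D)) = n * \<alpha> D"
    if "finite M" "M \<subseteq> A" "polyhedral_cone D"
      "\<forall>a\<in>A - M. D \<subseteq> {x. a \<bullet> x \<le> 0} \<or> D \<subseteq> {x. a \<bullet> x \<ge> 0}" for M D
    using that
  proof (induction M arbitrary: D rule: finite_induct)
    case empty
    show ?case
    proof (cases "aff_dim D < int DIM('a)")
      case True
      have "\<alpha> (C i \<inter> D) = 0" if "i \<in> I" for i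
      proof -
        have "aff_dim (C i \<inter> D) \<le> aff_dim D"
          by (rule aff_dim_subset) auto
        then show ?thesis
          using \<alpha> True polyhedral_cone_Int[OF C[OF that] empty(2)]
          by (auto simp: cone_angle_def)
      qed
      then show ?thesis
        using True \<alpha> empty by (auto simp: cone_angle_def)
    next
      case False
      then have "aff_dim D = int DIM('a)"
        using aff_dim_le_DIM[of D] by linarith
      moreover have "convex D" "D \<noteq> {}"
        using empty by (auto simp: polyhedral_cone_def convex_cone_def)
      ultimately have "interior D \<noteq> {}"
        by (metis aff_dim_eq_full rel_interior_eq_empty rel_interior_interior)
      then obtain p where p: "p \<in> interior D" "\<forall>a\<in>A. a \<bullet> p \<noteq> 0"
        using open_avoids_hyperplanes[of "interior D" A] A by auto
      then have pD: "p \<in> D"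
        using interior_subset by blast
      \<comment> \<open>If \<open>p\<close> lies in \<open>C i\<close>, so does all of
        \<open>D\<close>. Otherwise some inequality of \<open>C i\<close> fails at \<open>p\<close>,
        hence \<open>D\<close> lies on its wrong side and meets \<open>C i\<close> only within the
        hyperplane.\<close>
      have "w i * \<alpha> (C i \<inter> D) = w i * indicator (C i) p * \<alpha> D" if i: "i \<in> I" for i
      proof (cases "p \<in> C i")
        case True
        have "D \<subseteq> {x. a \<bullet> x \<le> 0}" if "a \<in> N i" for a
        proof -
          have "a \<in> A" using that i by (auto simp: A_def)
          moreover have "a \<bullet> p \<le> 0" using True N[OF i] that by auto
          ultimately have "\<not> D \<subseteq> {x. a \<bullet> x \<ge> 0}"
            using p(2) pD by force
          then show ?thesis
            using empty(3) \<open>a \<in> A\<close> by blast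
        qed
        then have "C i \<inter> D = D"
          using N[OF i] by blast
        then show ?thesis
          using True by simp
      next
        case False
        then obtain a where a: "a \<in> N i" "a \<bullet> p > 0"
          using N[OF i] by (auto simp: not_le)
        then have "a \<in> A" using i by (auto simp: A_def)
        then have "D \<subseteq> {x. a \<bullet> x \<ge> 0}"
          using empty(3) a(2) pD by force
        then have "C i \<inter> D \<subseteq> {x. a \<bullet> x = 0}"
          using N[OF i] a(1) by force
        then have "\<alpha> (C i \<inter> D) = 0"
          using \<open>a \<in> A\<close> A(2)
          by (intro cone_angle_low_dim[OF \<alpha> polyhedral_cone_Int[OF C[OF i] empty(2)]]) auto
        then show ?thesis
          using False by simp
      qed
      then have "(\<Sum>i\<in>I. w i * \<alpha> (C i \<inter> D)) = (\<Sum>i\<in>I. w i * indicator (C i) p) * \<alpha> D"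
        unfolding sum_distrib_right by (rule sum.cong[OF refl])
      also have "\<dots> = n * \<alpha> D"
        using ind[of p] p(2) by (simp add: A_def)
      finally show ?thesis .
    qed
  next
    case (insert a M)
    let ?L = "{x. a \<bullet> x \<le> 0}" and ?R = "{x. a \<bullet> x \<ge> 0}"
    have a: "a \<noteq> 0"
      using insert A by auto
    have "(\<Sum>i\<in>I. w i * \<alpha> (C i \<inter> (D \<inter> ?L))) = n * \<alpha> (D \<inter> ?L)"
      using insert.prems
      by (intro insert.IH)
        (auto intro!: polyhedral_cone_Int polyhedral_cone_halfspace_le)
    moreover have "(\<Sum>i\<in>I. w i * \<alpha> (C i \<inter> (D \<inter> ?R))) = n * \<alpha> (D \<inter> ?R)"
      using insert.prems
      by (intro insert.IH)
        (auto intro!: polyhedral_cone_Int polyhedral_cone_halfspace_ge)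
    moreover have "(\<Sum>i\<in>I. w i * \<alpha> (C i \<inter> D))
        = (\<Sum>i\<in>I. w i * \<alpha> (C i \<inter> (D \<inter> ?L)) + w i * \<alpha> (C i \<inter> (D \<inter> ?R)))"
    proof (rule sum.cong[OF refl])
      fix i assume "i \<in> I"
      then show "w i * \<alpha> (C i \<inter> D) = w i * \<alpha> (C i \<inter> (D \<inter> ?L)) + w i * \<alpha> (C i \<inter> (D \<inter> ?R))"
        using cone_angle_split[OF \<alpha> polyhedral_cone_Int[OF C insert.prems(2)] a, of i]
        by (simp add: Int_assoc distrib_left)
    qed
    ultimately show ?case
      by (simp add: sum.distrib distrib_left cone_angle_split[OF \<alpha> insert.prems(2) a])
  qed
  \<comment> \<open>With \<open>M = A\<close> the sidedness condition is vacuous, and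
    \<open>\<alpha> UNIV = 1\<close>.\<close>
  from this[of A UNIV] show ?thesis
    using A \<alpha> by (simp add: polyhedral_cone_UNIV cone_angle_def)
qed

section \<open>Euler characteristics of arrangement cells\<close>

text \<open>On relatively open convex sets this is the Euler characteristic with compact supports.\<close>

definition euler_sign :: "'a::euclidean_space set \<Rightarrow> real"
  where "euler_sign S = (if S = {} then 0 else (-1) ^ nat (aff_dim S))"

lemma euler_sign_empty [simp]: "euler_sign {} = 0"
  by (simp add: euler_sign_def)

lemma rel_open_Int_open:
  fixes S :: "'a::euclidean_space set"
  assumes "rel_open S" "convex S" "open T"
  shows "rel_open (S \<inter> T)"
proof (cases "S \<inter> T = {}")
  case True
  then show ?thesis by (simp add: rel_open_def)
next
  case False
  have "openin (top_of_set (affine hull S)) (S \<inter> T)"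
    using assms by (auto simp: rel_open intro: openin_Int_open)
  then show ?thesis
    using affine_hull_convex_Int_open[OF assms(2,3) False] by (simp add: rel_open)
qed

text \<open>A relatively open \<open>S\<close> is the trace of an open \<open>T\<close> on its
  affine hull. The slice is then the trace of \<open>T\<close> on a smaller flat, and a nonempty
  trace of an open set spans that flat.\<close>

lemma hyperplane_split_rel_open:
  fixes S :: "'a::euclidean_space set"
  assumes S: "rel_open S" "convex S" and x: "x \<in> S" "a \<bullet> x = 0"
  shows "rel_open (S \<inter> {y. a \<bullet> y = 0})"
    and "affine hull (S \<inter> {y. a \<bullet> y = 0}) = affine hull S \<inter> {y. a \<bullet> y = 0}"
proof -
  let ?H = "{y. a \<bullet> y = 0}"
  have aff: "affine (affine hull S \<inter> ?H)"
    by (simp add: affine_Int affine_hyperplane)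
  obtain T where T: "open T" "S = affine hull S \<inter> T"
    using S by (auto simp: rel_open openin_open)
  then have eq: "S \<inter> ?H = (affine hull S \<inter> ?H) \<inter> T"
    by blast
  have "(affine hull S \<inter> ?H) \<inter> T \<noteq> {}"
    using x eq by blast
  then have "affine hull ((affine hull S \<inter> ?H) \<inter> T) = affine hull (affine hull S \<inter> ?H)"
    by (rule affine_hull_affine_Int_open[OF aff T(1)])
  also have "\<dots> = affine hull S \<inter> ?H"
    using aff by (rule hull_same)
  finally show hull: "affine hull (S \<inter> ?H) = affine hull S \<inter> ?H"
    using eq by simp
  have "openin (top_of_set (affine hull S \<inter> ?H)) (S \<inter> ?H)"
    unfolding eq using T(1) by (simp add: openin_open_Int)
  then show "rel_open (S \<inter> ?H)"
    unfolding rel_open hull .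
qed

lemma rel_open_Int_hyperplane:
  fixes S :: "'a::euclidean_space set"
  assumes "rel_open S" "convex S"
  shows "rel_open (S \<inter> {y. a \<bullet> y = 0})"
proof (cases "S \<inter> {y. a \<bullet> y = 0} = {}")
  case True
  then show ?thesis by (simp add: rel_open_def)
qed (use hyperplane_split_rel_open(1)[OF assms] in blast)

text \<open>The segment from \<open>y\<close> to \<open>x\<close> can be prolonged beyond
  \<open>x\<close> inside \<open>S\<close>, and \<open>a\<close> changes sign at
  \<open>x\<close>.\<close>

lemma rel_open_extends_segment:
  fixes S :: "'a::euclidean_space set"
  assumes S: "rel_open S" "convex S" and "x \<in> S" "a \<bullet> x = 0" "y \<in> S" "a \<bullet> y \<noteq> 0"
  obtains z where "z \<in> S" "(a \<bullet> z) * (a \<bullet> y) < 0"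
proof -
  obtain e where e: "e > 1" "(1 - e) *\<^sub>R y + e *\<^sub>R x \<in> S"
    using convex_rel_interior_iff[of S x] assms by (auto simp: rel_open_def)
  have "(a \<bullet> ((1 - e) *\<^sub>R y + e *\<^sub>R x)) * (a \<bullet> y) = (1 - e) * (a \<bullet> y)\<^sup>2"
    using assms by (simp add: inner_add_right power2_eq_square)
  also have "\<dots> < 0"
    using e assms by (simp add: mult_neg_pos)
  finally show thesis
    using that e by blast
qed

text \<open>If the hyperplane properly cuts \<open>S\<close>, the two open sides have the dimension
  of \<open>S\<close> and the slice has one less, so two of the three terms cancel. In all other
  cases, by connectedness when the slice is empty, \<open>S\<close> is a single one of the three
  pieces.\<close>

lemma euler_sign_split:
  fixes S :: "'a::euclidean_space set"
  assumes S: "rel_open S" "convex S"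
  shows "euler_sign S = euler_sign (S \<inter> {y. a \<bullet> y < 0}) + euler_sign (S \<inter> {y. a \<bullet> y = 0})
    + euler_sign (S \<inter> {y. a \<bullet> y > 0})"
    (is "_ = euler_sign ?L + euler_sign ?M + euler_sign ?R")
proof (cases "?M = {}")
  case True
  have "?L = {} \<or> ?R = {}"
  proof (rule ccontr)
    assume "\<not> ?thesis"
    then obtain u v where uv: "u \<in> S" "a \<bullet> u < 0" "v \<in> S" "a \<bullet> v > 0"
      by blast
    have "\<exists>z\<in>S. a \<bullet> z = 0"
      using uv convex_connected[OF S(2)]
        connected_ivt_hyperplane[of S u v a 0] by fastforce
    then show False
      using True by blast
  qed
  then show ?thesis
  proof
    assume e: "?L = {}"
    have "a \<bullet> y > 0" if "y \<in> S" for y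
    proof -
      have "\<not> a \<bullet> y < 0" "a \<bullet> y \<noteq> 0"
        using that e True by blast+
      then show ?thesis by linarith
    qed
    then have "?R = S"
      by blast
    then show ?thesis
      unfolding e True by simp
  next
    assume e: "?R = {}"
    have "a \<bullet> y < 0" if "y \<in> S" for y
    proof -
      have "\<not> a \<bullet> y > 0" "a \<bullet> y \<noteq> 0"
        using that e True by blast+
      then show ?thesis by linarith
    qed
    then have "?L = S"
      by blast
    then show ?thesis
      unfolding e True by simp
  qed
next
  case False
  then obtain x where x: "x \<in> S" "a \<bullet> x = 0"
    by blast
  show ?thesis
  proof (cases "S \<subseteq> {y. a \<bullet> y = 0}")
    case True
    then have "?L = {}" "?R = {}" "?M = S"
      by force+
    then show ?thesis by simp
  next
    case False
    then obtain y where y: "y \<in> S" "a \<bullet> y \<noteq> 0"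
      by blast
    then obtain z where z: "z \<in> S" "(a \<bullet> z) * (a \<bullet> y) < 0"
      using rel_open_extends_segment[OF S x] by blast
    have ne: "?L \<noteq> {}" "?R \<noteq> {}"
      using y z by (auto simp: mult_less_0_iff)
    have dims: "aff_dim ?L = aff_dim S" "aff_dim ?R = aff_dim S"
      using ne S(2) by (auto intro!: aff_dim_convex_Int_open open_halfspace_lt open_halfspace_gt)
    have "aff_dim ?M = aff_dim (affine hull S \<inter> {y. a \<bullet> y = 0})"
      using hyperplane_split_rel_open(2)[OF S x] by (metis aff_dim_affine_hull)
    also have "\<dots> = aff_dim S - 1"
    proof -
      have "x \<in> affine hull S" "y \<in> affine hull S"
        using x y by (auto intro: hull_inc)
      then have "affine hull S \<inter> {y. a \<bullet> y = 0} \<noteq> {}" "\<not> affine hull S \<subseteq> {y. a \<bullet> y = 0}"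
        using x y by blast+
      then show ?thesis
        by (simp add: aff_dim_affine_Int_hyperplane)
    qed
    finally have dimM: "aff_dim ?M = aff_dim S - 1" .
    moreover have "aff_dim ?M \<ge> 0"
      using \<open>?M \<noteq> {}\<close> by (metis aff_dim_negative_iff not_le)
    ultimately have "nat (aff_dim S) = Suc (nat (aff_dim ?M))"
      by linarith
    moreover have "S \<noteq> {}" using x by blast
    ultimately show ?thesis
      using ne \<open>?M \<noteq> {}\<close> dims by (simp add: euler_sign_def)
  qed
qed

text \<open>Each vector of \<open>A\<close> splits every piece in three, so
  \<open>euler_sign_split\<close> is iterated. Sign vectors that no point realizes contribute 0
  because their cell is empty.\<close>

lemma euler_sign_sum_sign_vectors:
  fixes S :: "'a::euclidean_space set"
  assumes "finite A" "rel_open S" "convex S"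
  shows "(\<Sum>s\<in>A \<rightarrow>\<^sub>E {-1, 0, 1}. euler_sign (S \<inter> {c. \<forall>a\<in>A. sgn (a \<bullet> c) = s a})) = euler_sign S"
  using assms
proof (induction A arbitrary: S rule: finite_induct)
  case empty
  then show ?case by simp
next
  case (insert a A)
  let ?V = "{-1, 0, 1::real}"
  let ?cell = "\<lambda>s. {c. \<forall>b\<in>A. sgn (b \<bullet> c) = s b}"
  let ?T = "\<lambda>v::real. S \<inter> {c. sgn (a \<bullet> c) = v}"
  have cell: "{c. \<forall>b\<in>insert a A. sgn (b \<bullet> c) = (s(a := v)) b} = {c. sgn (a \<bullet> c) = v} \<inter> ?cell s"
    for s v
    using insert(2) by (auto simp: fun_upd_def) 
  have T: "?T (-1) = S \<inter> {c. a \<bullet> c < 0}" "?T 0 = S \<inter> {c. a \<bullet> c = 0}" "?T 1 = S \<inter> {c. a \<bullet> c > 0}"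
    by (auto simp: sgn_if)
  have IH: "(\<Sum>s\<in>A \<rightarrow>\<^sub>E ?V. euler_sign (?T v \<inter> ?cell s)) = euler_sign (?T v)" if "v \<in> ?V" for v
  proof (rule insert.IH)
    show "rel_open (?T v)"
      using that T insert.prems rel_open_Int_open[OF insert.prems open_halfspace_lt]
        rel_open_Int_open[OF insert.prems open_halfspace_gt] rel_open_Int_hyperplane[OF insert.prems]
      by auto
    show "convex (?T v)"
      using that T convex_Int[OF insert.prems(2) convex_halfspace_lt]
        convex_Int[OF insert.prems(2) convex_halfspace_gt]
        convex_Int[OF insert.prems(2) convex_hyperplane]
      by auto
  qed
  have "(\<Sum>s\<in>insert a A \<rightarrow>\<^sub>E ?V. euler_sign (S \<inter> {c. \<forall>b\<in>insert a A. sgn (b \<bullet> c) = s b}))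
      = (\<Sum>(v, s)\<in>?V \<times> (A \<rightarrow>\<^sub>E ?V). euler_sign (?T v \<inter> ?cell s))"
    unfolding PiE_insert_eq
    by (subst sum.reindex[OF inj_combinator[OF insert(2)]])
      (simp only: o_def case_prod_unfold cell Int_assoc)
  also have "\<dots> = (\<Sum>v\<in>?V. euler_sign (?T v))"
    by (subst sum.cartesian_product[symmetric]) (use IH in \<open>auto intro!: sum.cong\<close>)
  also have "\<dots> = euler_sign S"
    using T by (simp add: euler_sign_split[OF insert.prems, of a])
  finally show ?case .
qed

text \<open>The cells may be indexed by any map with the same fibres as the sign vector. This is
  applied to the map sending a functional to the face on which it is maximal.\<close>

lemma euler_sign_sum_fibres:
  fixes S :: "'a::euclidean_space set" and \<phi> :: "'a \<Rightarrow> 'b"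
  assumes A: "finite A" and S: "rel_open S" "convex S"
    and \<phi>: "\<And>c c'. \<phi> c = \<phi> c' \<longleftrightarrow> (\<forall>a\<in>A. sgn (a \<bullet> c) = sgn (a \<bullet> c'))"
  shows "(\<Sum>y\<in>range \<phi>. euler_sign (S \<inter> {c. \<phi> c = y})) = euler_sign S"
proof -
  define \<sigma> where "\<sigma> = (\<lambda>c. \<lambda>a\<in>A. sgn (a \<bullet> c))"
  have \<sigma>: "\<sigma> c = \<sigma> c' \<longleftrightarrow> \<phi> c = \<phi> c'" for c c'
    unfolding \<phi> \<sigma>_def by (metis (mono_tags, lifting) restrict_apply' restrict_ext)
  have cell: "{c. \<forall>a\<in>A. sgn (a \<bullet> c) = s a} = {c. \<sigma> c = s}" if "s \<in> A \<rightarrow>\<^sub>E {-1, 0, 1}" for s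
    using that by (auto simp: \<sigma>_def fun_eq_iff PiE_def extensional_def)
  \<comment> \<open>\<open>inv \<phi> y\<close> is a representative of the fibre over
    \<open>y\<close>; its sign vector does not depend on the choice.\<close>
  have inj: "inj_on (\<lambda>y. \<sigma> (inv \<phi> y)) (range \<phi>)"
    by (rule inj_onI) (metis \<sigma> f_inv_into_f)
  have img: "(\<lambda>y. \<sigma> (inv \<phi> y)) ` range \<phi> = range \<sigma>"
    using \<sigma> by (force simp: image_iff f_inv_into_f)
  have "euler_sign S = (\<Sum>s\<in>A \<rightarrow>\<^sub>E {-1, 0, 1}. euler_sign (S \<inter> {c. \<sigma> c = s}))"
    by (subst euler_sign_sum_sign_vectors[OF A S, symmetric]) (use cell in \<open>simp cong: sum.cong\<close>)
  also have "\<dots> = (\<Sum>s\<in>range \<sigma>. euler_sign (S \<inter> {c. \<sigma> c = s}))"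
  proof (rule sum.mono_neutral_right)
    show "range \<sigma> \<subseteq> A \<rightarrow>\<^sub>E {-1, 0, 1}"
      by (auto simp: \<sigma>_def sgn_real_def split: if_splits)
    show "\<forall>s\<in>(A \<rightarrow>\<^sub>E {-1, 0, 1}) - range \<sigma>. euler_sign (S \<inter> {c. \<sigma> c = s}) = 0"
      by (auto simp: euler_sign_def)
  qed (use A in \<open>auto intro: finite_PiE\<close>)
  also have "\<dots> = (\<Sum>y\<in>range \<phi>. euler_sign (S \<inter> {c. \<phi> c = y}))"
    unfolding img[symmetric]
    by (subst sum.reindex[OF inj]) (auto intro!: sum.cong simp: \<sigma> f_inv_into_f)
  finally show ?thesis
    by simp
qed

section \<open>Orthogonal projections, tangent cones and ranks\<close>

text \<open>\<open>\<pi>\<close> is the orthogonal projection with kernel \<open>U\<close>,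
  specified by two membership conditions alone; self-adjointness and the kernel are derived from
  these below.\<close>

lemma subspace_orthogonal_decomp:
  fixes U :: "'a::euclidean_space set"
  assumes "subspace U"
  obtains \<pi> where "\<And>x. \<pi> x \<in> U\<^sup>\<bottom>" "\<And>x. x - \<pi> x \<in> U"
proof -
  have "\<exists>z. z \<in> U\<^sup>\<bottom> \<and> x - z \<in> U" for x
  proof -
    have "span U = U"
      using assms by simp
    then obtain y z where "y \<in> U" "\<And>w. w \<in> U \<Longrightarrow> orthogonal z w" "x = y + z"
      using orthogonal_subspace_decomp_exists[of U x] by metis
    then show ?thesis
      by (intro exI[of _ z]) (auto simp: orthogonal_comp_def orthogonal_commute)
  qed
  then show thesis
    using that by metis
qed

lemma orthogonal_projection_self_adjoint:
  fixes U :: "'a::euclidean_space set"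
  assumes \<pi>: "\<And>x. \<pi> x \<in> U\<^sup>\<bottom>" "\<And>x. x - \<pi> x \<in> U"
  shows "\<pi> x \<bullet> y = x \<bullet> \<pi> y"
proof -
  have *: "\<pi> x \<bullet> (y - \<pi> y) = 0" for x y
    using \<pi>(1)[of x] \<pi>(2)[of y] by (auto simp: orthogonal_comp_def orthogonal_def inner_commute)
  show ?thesis
    using *[of x y] *[of y x] by (simp add: inner_diff_right inner_commute)
qed

lemma orthogonal_projection_eq_0_iff:
  fixes U :: "'a::euclidean_space set"
  assumes U: "subspace U" and \<pi>: "\<And>x. \<pi> x \<in> U\<^sup>\<bottom>" "\<And>x. x - \<pi> x \<in> U"
  shows "\<pi> x = 0 \<longleftrightarrow> x \<in> U"
proof
  assume "\<pi> x = 0"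
  then show "x \<in> U" using \<pi>(2)[of x] by simp
next
  assume "x \<in> U"
  then have "x - (x - \<pi> x) \<in> U"
    by (rule subspace_diff[OF U _ \<pi>(2)])
  then have "\<pi> x \<bullet> \<pi> x = 0"
    using \<pi>(1)[of x] by (auto simp: orthogonal_comp_def orthogonal_def)
  then show "\<pi> x = 0" by simp
qed

lemma dim_orthogonal_comp:
  fixes U :: "'a::euclidean_space set"
  assumes "subspace U"
  shows "dim (U\<^sup>\<bottom>) = DIM('a) - dim U"
  using dim_subspace_orthogonal_to_vectors[OF assms subspace_UNIV] 
  by (simp add: orthogonal_comp_def)

lemma orthogonal_comp_span: "(span B)\<^sup>\<bottom> = {c. \<forall>b\<in>B. b \<bullet> c = 0}"
  for B :: "'a::euclidean_space set"
proof -
  have "span B \<subseteq> {x. x \<bullet> c = 0}" if "\<forall>b\<in>B. b \<bullet> c = 0" for c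
    using that by (intro span_minimal) (auto simp: subspace_def inner_add_left)
  then show ?thesis
    by (auto simp: orthogonal_comp_def orthogonal_def intro: span_base)
qed

lemma aff_dim_eq_dim_lin_space:
  fixes F :: "'a::euclidean_space set"
  assumes "F \<noteq> {}"
  shows "aff_dim F = int (dim (lin_space F))"
proof -
  have L: "subspace (lin_space F)"
    by (rule lin_space_parallel(1)[OF assms])
  then have "affine hull (lin_space F) = lin_space F"
    by (simp add: hull_same subspace_imp_affine)
  then have "aff_dim F = aff_dim (lin_space F)"
    using lin_space_parallel(2)[OF assms] by (intro aff_dim_parallel_eq) (simp only:)
  then show ?thesis
    by (simp add: aff_dim_subspace[OF L])
qed

section \<open>Tangent cones as polars of normal cones\<close>

lemma polyhedral_cone_tangent_cone:
  fixes P :: "'a::euclidean_space set"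
  assumes "polytope P"
  shows "polyhedral_cone (tangent_cone F P)"
proof -
  have "polytope ((\<lambda>x. - q + x) ` P)" for q
    using assms by (simp only: polytope_translation_eq)
  then show ?thesis
    unfolding tangent_cone_def Let_def polyhedral_cone_def
    using convex_cone_convex_cone_hull polyhedron_convex_cone_hull_polytope by blast
qed

text \<open>The normals of any homogeneous inequality system for the tangent cone already belong to
  the normal cone, so the inequalities from the normal cone cut out no larger set.\<close>

lemma tangent_cone_polar_normal_cone:
  fixes P :: "'a::euclidean_space set"
  assumes P: "polytope P" and F: "F face_of P" "F \<noteq> {}"
  shows "x \<in> tangent_cone F P \<longleftrightarrow> (\<forall>c\<in>normal_cone F P. c \<bullet> x \<le> 0)"
proof -
  have FP: "F \<subseteq> P" and conv: "convex F"
    using F by (auto dest: face_of_imp_subset face_of_imp_convex)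
  obtain q where q: "q \<in> rel_interior F"
    using rel_interior_eq_empty[OF conv] F(2) by blast
  then have "q \<in> F"
    using rel_interior_subset by blast
  have T: "tangent_cone F P = convex_cone hull ((\<lambda>x. - q + x) ` P)"
    by (rule tangent_cone_eq[OF FP conv q])
  obtain N where N: "finite N" "0 \<notin> N" "tangent_cone F P = {x. \<forall>a\<in>N. a \<bullet> x \<le> 0}"
    by (rule polyhedral_cone_halfspaces[OF polyhedral_cone_tangent_cone[OF P]])
  have "N \<subseteq> normal_cone F P"
  proof
    fix a assume "a \<in> N"
    have le: "a \<bullet> y \<le> a \<bullet> q" if "y \<in> P" for y
    proof -
      have "- q + y \<in> tangent_cone F P"
        unfolding T using that by (simp add: hull_inc)
      then have "a \<bullet> (- q + y) \<le> 0"
        using N(3) \<open>a \<in> N\<close> by blast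
      then show ?thesis
        by (simp add: inner_diff_right)
    qed
    \<comment> \<open>As \<open>q\<close> is relatively interior, the segment from \<open>y\<close>
      can be continued past \<open>q\<close> within \<open>F\<close>. A functional that is maximal
      at \<open>q\<close> cannot increase there, so it is constant on \<open>F\<close>.\<close>
    have "a \<bullet> q \<le> a \<bullet> y" if y: "y \<in> F" for y
    proof -
      obtain e where e: "e > 1" "(1 - e) *\<^sub>R y + e *\<^sub>R q \<in> F"
        using convex_rel_interior_iff[OF conv] F(2) q y by blast
      then have "a \<bullet> ((1 - e) *\<^sub>R y + e *\<^sub>R q) \<le> a \<bullet> q"
        using le FP by blast
      then have "(e - 1) * (a \<bullet> q) \<le> (e - 1) * (a \<bullet> y)"
        by (simp add: inner_add_right algebra_simps)
      then show ?thesis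
        using e(1) by simp
    qed
    with le show "a \<in> normal_cone F P"
      unfolding normal_cone_def by (auto intro: order_trans)
  qed
  moreover have "tangent_cone F P \<subseteq> {x. c \<bullet> x \<le> 0}" if c: "c \<in> normal_cone F P" for c
    unfolding T
  proof (rule hull_minimal)
    have "c \<bullet> y \<le> c \<bullet> q" if "y \<in> P" for y
      using c that \<open>q \<in> F\<close> by (auto simp: normal_cone_def)
    then show "(\<lambda>x. - q + x) ` P \<subseteq> {x. c \<bullet> x \<le> 0}"
      by (auto simp: inner_diff_right)
    show "convex_cone {x. c \<bullet> x \<le> 0}"
      using polyhedral_cone_halfspace_le by (auto simp: polyhedral_cone_def)
  qed
  ultimately show ?thesis
    using N(3) by blast
qed

section \<open>Ranks by bounding chains\<close>

lemma poset_rank_eq_chain: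
  assumes fin: "finite (Field r)"
    and le: "\<And>C. \<lbrakk>C \<in> Chains r; C \<subseteq> under r a\<rbrakk> \<Longrightarrow> card C \<le> Suc n"
    and C: "C \<in> Chains r" "C \<subseteq> under r a" "card C = Suc n"
  shows "poset_rank r a = n"
  unfolding poset_rank_def
proof (rule Max_eqI)
  have "finite (under r a)"
    by (rule finite_subset[OF _ fin]) (auto simp: under_def Field_def)
  then show "finite ((\<lambda>C. card C - 1) ` {C \<in> Chains r. C \<subseteq> under r a})"
    by (auto intro: finite_subset[of _ "Pow (under r a)"])
  show "y \<le> n" if "y \<in> (\<lambda>C. card C - 1) ` {C \<in> Chains r. C \<subseteq> under r a}" for y
    using that le by fastforce
  show "n \<in> (\<lambda>C. card C - 1) ` {C \<in> Chains r. C \<subseteq> under r a}"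
    using C by force
qed

text \<open>Nested subspaces of equal dimension coincide, so dimension is injective on a
  chain.\<close>

lemma card_chain_of_subspaces_le:
  fixes C :: "'a::euclidean_space set set"
  assumes "\<And>X. X \<in> C \<Longrightarrow> subspace X" "\<And>X Y. X \<in> C \<Longrightarrow> Y \<in> C \<Longrightarrow> X \<subseteq> Y \<or> Y \<subseteq> X"
    and "dim ` C \<subseteq> {i..j}"
  shows "card C \<le> Suc (j - i)"
proof -
  have "inj_on dim C"
    by (rule inj_onI) (metis assms(1,2) order_refl subspace_dim_equal)
  then have "card C = card (dim ` C)"
    by (simp add: card_image)
  also have "\<dots> \<le> card {i..j}"
    using assms(3) by (intro card_mono) auto
  also have "\<dots> \<le> Suc (j - i)"
    by simp
  finally show ?thesis .
qed

section \<open>Faces of a zonotope\<close>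

text \<open>Segment \<open>k\<close> runs from \<open>p k\<close> to \<open>p k + g k\<close>.
  Generators may vanish, repeat or be parallel; that they span the space is assumed only in the
  lemmas that use it.\<close>

locale zonotope_generators =
  fixes p g :: "nat \<Rightarrow> 'a::euclidean_space" and m :: nat
begin

definition cube :: "(nat \<Rightarrow> real) set"
  where "cube = {t. \<forall>k<m. 0 \<le> t k \<and> t k \<le> 1}"

definition pt :: "(nat \<Rightarrow> real) \<Rightarrow> 'a"
  where "pt t = (\<Sum>k<m. p k + t k *\<^sub>R g k)"

definition Z :: "'a set"
  where "Z = pt ` cube"

definition face :: "'a \<Rightarrow> 'a set"
  where "face c = {x \<in> Z. \<forall>y\<in>Z. c \<bullet> y \<le> c \<bullet> x}"

text \<open>Coordinates of the midpoint of \<open>face c\<close>: those forced by the sign of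
  \<open>c \<bullet> g k\<close> are 1 or 0, the free ones are 1/2. The signs can therefore be read
  off from this one point.\<close>

definition centre :: "'a \<Rightarrow> nat \<Rightarrow> real"
  where "centre c k = (if c \<bullet> g k > 0 then 1 else if c \<bullet> g k < 0 then 0 else 1 / 2)"

lemma Z_eq_sum: "Z = (\<Sum>k<m. closed_segment (p k) (p k + g k))"
proof -
  have seg: "closed_segment (p k) (p k + g k) = {p k + u *\<^sub>R g k | u. 0 \<le> u \<and> u \<le> 1}" for k
    by (auto simp: closed_segment_def algebra_simps)
  show ?thesis
  proof (rule set_eqI, rule iffI)
    fix x assume "x \<in> Z"
    then obtain t where t: "t \<in> cube" "x = pt t"
      by (auto simp: Z_def)
    then show "x \<in> (\<Sum>k<m. closed_segment (p k) (p k + g k))"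
      by (auto simp: set_sum_alt seg pt_def cube_def intro!: exI[of _ "\<lambda>k. p k + t k *\<^sub>R g k"])
  next
    fix x assume "x \<in> (\<Sum>k<m. closed_segment (p k) (p k + g k))"
    then obtain s where s: "x = sum s {..<m}" "\<forall>k<m. \<exists>u. s k = p k + u *\<^sub>R g k \<and> 0 \<le> u \<and> u \<le> 1"
      by (auto simp: set_sum_alt seg)
    then obtain t where t: "\<forall>k<m. s k = p k + t k *\<^sub>R g k \<and> 0 \<le> t k \<and> t k \<le> 1"
      by metis
    then have "x = pt t" "t \<in> cube"
      using s by (auto simp: pt_def cube_def intro!: sum.cong)
    then show "x \<in> Z"
      by (auto simp: Z_def)
  qed
qed

lemma polytope_Z: "polytope Z"
proof -
  have "finite (\<Sum>k\<in>K. {p k, p k + g k})" if "finite K" for K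
    using that by (induction K rule: finite_induct) (auto intro: finite_set_plus)
  moreover have "Z = convex hull (\<Sum>k<m. {p k, p k + g k})"
    unfolding Z_eq_sum convex_hull_set_sum by (simp add: segment_convex_hull)
  ultimately show ?thesis
    unfolding polytope_def by blast
qed

lemma convex_Z: "convex Z"
  using polytope_Z by (rule polytope_imp_convex)

lemma inner_pt: "c \<bullet> pt t = (\<Sum>k<m. c \<bullet> p k) + (\<Sum>k<m. t k * (c \<bullet> g k))"
  by (simp add: pt_def inner_sum_right inner_add_right sum.distrib)

lemma pt_upd:
  assumes "k < m"
  shows "pt (t(k := v)) = pt t + (v - t k) *\<^sub>R g k"
proof -
  have "pt s = (p k + s k *\<^sub>R g k) + (\<Sum>j\<in>{..<m} - {k}. p j + s j *\<^sub>R g j)" for s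
    unfolding pt_def using assms by (simp add: sum.remove)
  moreover have "(\<Sum>j\<in>{..<m} - {k}. p j + (t(k := v)) j *\<^sub>R g j) = (\<Sum>j\<in>{..<m} - {k}. p j + t j *\<^sub>R g j)"
    by (rule sum.cong) auto
  ultimately show ?thesis
    by (simp add: algebra_simps)
qed

text \<open>By \<open>inner_pt\<close> the functional is a sum of terms in one coordinate each, so
  it is maximal iff every coordinate maximizes its own term. Moving a single coordinate to 1 or 0
  proves necessity.\<close>

lemma pt_mem_face_iff:
  assumes t: "t \<in> cube"
  shows "pt t \<in> face c \<longleftrightarrow> (\<forall>k<m. (c \<bullet> g k > 0 \<longrightarrow> t k = 1) \<and> (c \<bullet> g k < 0 \<longrightarrow> t k = 0))"
proof
  assume L: "pt t \<in> face c"
  show "\<forall>k<m. (c \<bullet> g k > 0 \<longrightarrow> t k = 1) \<and> (c \<bullet> g k < 0 \<longrightarrow> t k = 0)"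
  proof (intro allI impI)
    fix k assume k: "k < m"
    have le: "(v - t k) * (c \<bullet> g k) \<le> 0" if "0 \<le> v" "v \<le> 1" for v
    proof -
      have "t(k := v) \<in> cube"
        using t that by (auto simp: cube_def)
      then have "c \<bullet> pt (t(k := v)) \<le> c \<bullet> pt t"
        using L by (auto simp: face_def Z_def)
      then show ?thesis
        by (simp add: pt_upd[OF k] inner_add_right)
    qed
    show "(c \<bullet> g k > 0 \<longrightarrow> t k = 1) \<and> (c \<bullet> g k < 0 \<longrightarrow> t k = 0)"
      using le[of 1] le[of 0] t k by (auto simp: cube_def mult_le_0_iff zero_le_mult_iff)
  qed
next
  assume R: "\<forall>k<m. (c \<bullet> g k > 0 \<longrightarrow> t k = 1) \<and> (c \<bullet> g k < 0 \<longrightarrow> t k = 0)"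
  have "c \<bullet> pt s \<le> c \<bullet> pt t" if "s \<in> cube" for s
    unfolding inner_pt
  proof (intro add_left_mono sum_mono)
    fix k assume "k \<in> {..<m}"
    then have k: "k < m" by simp
    then have s: "0 \<le> s k" "s k \<le> 1"
      using that by (auto simp: cube_def)
    consider "c \<bullet> g k > 0" "t k = 1" | "c \<bullet> g k < 0" "t k = 0" | "c \<bullet> g k = 0"
      using R k by (meson linorder_neqE_linordered_idom)
    then show "s k * (c \<bullet> g k) \<le> t k * (c \<bullet> g k)"
      by cases (use s in \<open>auto simp: mult_nonneg_nonpos\<close>)
  qed
  then show "pt t \<in> face c"
    using t by (auto simp: face_def Z_def)
qed

lemma centre_in_cube: "centre c \<in> cube"
  by (auto simp: cube_def centre_def)

lemma pt_centre_in_face: "pt (centre c) \<in> face c"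
  by (auto simp: pt_mem_face_iff[OF centre_in_cube] centre_def)

lemma face_nonempty: "face c \<noteq> {}"
  using pt_centre_in_face by blast

lemma face_subset_Z: "face c \<subseteq> Z"
  by (auto simp: face_def)

text \<open>For the forward direction it suffices to test \<open>centre c\<close>, whose coordinates
  are 1 or 0 only where the sign of \<open>c \<bullet> g k\<close> forces it.\<close>

lemma face_subset_iff:
  "face c \<subseteq> face c' \<longleftrightarrow>
    (\<forall>k<m. (c' \<bullet> g k > 0 \<longrightarrow> c \<bullet> g k > 0) \<and> (c' \<bullet> g k < 0 \<longrightarrow> c \<bullet> g k < 0))"
proof
  assume "face c \<subseteq> face c'"
  then have "pt (centre c) \<in> face c'"
    using pt_centre_in_face by blast
  then have "\<forall>k<m. (c' \<bullet> g k > 0 \<longrightarrow> centre c k = 1) \<and> (c' \<bullet> g k < 0 \<longrightarrow> centre c k = 0)"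
    by (simp add: pt_mem_face_iff[OF centre_in_cube])
  then show "\<forall>k<m. (c' \<bullet> g k > 0 \<longrightarrow> c \<bullet> g k > 0) \<and> (c' \<bullet> g k < 0 \<longrightarrow> c \<bullet> g k < 0)"
    by (auto simp: centre_def split: if_splits)
next
  assume R: "\<forall>k<m. (c' \<bullet> g k > 0 \<longrightarrow> c \<bullet> g k > 0) \<and> (c' \<bullet> g k < 0 \<longrightarrow> c \<bullet> g k < 0)"
  show "face c \<subseteq> face c'"
  proof
    fix x assume x: "x \<in> face c"
    then obtain t where t: "t \<in> cube" "x = pt t"
      by (auto simp: face_def Z_def)
    then show "x \<in> face c'"
      using x R by (simp add: pt_mem_face_iff)
  qed
qed

lemma face_eq_iff: "face c = face c' \<longleftrightarrow> (\<forall>a\<in>g ` {..<m}. sgn (a \<bullet> c) = sgn (a \<bullet> c'))"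
proof -
  have "face c = face c' \<longleftrightarrow> face c \<subseteq> face c' \<and> face c' \<subseteq> face c"
    by blast
  also have "\<dots> \<longleftrightarrow> (\<forall>k<m. (c \<bullet> g k > 0 \<longleftrightarrow> c' \<bullet> g k > 0) \<and> (c \<bullet> g k < 0 \<longleftrightarrow> c' \<bullet> g k < 0))"
    unfolding face_subset_iff by blast
  also have "\<dots> \<longleftrightarrow> (\<forall>k<m. sgn (c \<bullet> g k) = sgn (c' \<bullet> g k))"
  proof -
    have "(r > 0 \<longleftrightarrow> s > 0) \<and> (r < 0 \<longleftrightarrow> s < 0) \<longleftrightarrow> sgn r = sgn s" for r s :: real
      by (auto simp: sgn_real_def)
    then show ?thesis by simp
  qed
  also have "\<dots> \<longleftrightarrow> (\<forall>a\<in>g ` {..<m}. sgn (c \<bullet> a) = sgn (c' \<bullet> a))"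
    by auto
  finally show ?thesis
    by (simp only: inner_commute)
qed

lemma face_0: "face 0 = Z"
  by (auto simp: face_def)

text \<open>Every face of a polyhedron is exposed, so the nonempty faces are exactly the maximizing
  sets of linear functionals, with \<open>c = 0\<close> giving \<open>Z\<close> itself.\<close>

lemma face_of_Z_iff: "F face_of Z \<and> F \<noteq> {} \<longleftrightarrow> F \<in> range face"
proof
  assume F: "F face_of Z \<and> F \<noteq> {}"
  then have "F exposed_face_of Z"
    using exposed_face_of_polyhedron polytope_Z polytope_imp_polyhedron by blast
  then obtain c b where "Z \<subseteq> {x. c \<bullet> x \<le> b}" "F = Z \<inter> {x. c \<bullet> x = b}"
    unfolding exposed_face_of_def by blast
  with F have "F = face c"
    by (force simp: face_def)
  then show "F \<in> range face" by blast
next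
  assume "F \<in> range face"
  then obtain c where c: "F = face c" by blast
  have "F = Z \<inter> {x. c \<bullet> x = c \<bullet> pt (centre c)}"
    using pt_centre_in_face[of c] unfolding c face_def by (auto intro!: antisym)
  moreover have "Z \<inter> {x. c \<bullet> x = c \<bullet> pt (centre c)} face_of Z"
    using pt_centre_in_face[of c]
    by (intro face_of_Int_supporting_hyperplane_le[OF convex_Z]) (auto simp: face_def)
  ultimately show "F face_of Z \<and> F \<noteq> {}"
    using c face_nonempty by metis
qed

lemma face_of_Z: "face c face_of Z"
  using face_of_Z_iff by blast

lemma finite_range_face: "finite (range face)"
proof -
  have "range face \<subseteq> {F. F face_of Z}"
    using face_of_Z by blast
  then show ?thesis
    using finite_polytope_faces[OF polytope_Z] finite_subset by blast
qed

text \<open>On \<open>face c\<close> the coordinates with \<open>c \<bullet> g k \<noteq> 0\<close>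
  are fixed, while the others range freely over the unit interval.\<close>

lemma lin_space_face: "lin_space (face c) = span {g k | k. k < m \<and> c \<bullet> g k = 0}"
  (is "_ = span ?G")
proof
  let ?q = "pt (centre c)"
  have sub: "subspace (lin_space (face c))"
    by (rule lin_space_parallel(1)[OF face_nonempty])
  show "span ?G \<subseteq> lin_space (face c)"
  proof (rule span_minimal[OF _ sub])
    show "?G \<subseteq> lin_space (face c)"
    proof
      fix x assume "x \<in> ?G"
      then obtain k where k: "k < m" "c \<bullet> g k = 0" "x = g k"
        by blast
      define t where "t v = (centre c)(k := v)" for v
      have "pt (t v) \<in> face c" if "0 \<le> v" "v \<le> 1" for v
      proof -
        have "t v \<in> cube"
          using centre_in_cube that by (auto simp: t_def cube_def)
        then show ?thesis
          by (subst pt_mem_face_iff) (use k in \<open>auto simp: t_def centre_def\<close>)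
      qed
      then have "pt (t 1) - pt (t 0) \<in> lin_space (face c)"
        unfolding lin_space_def
        by (intro CollectI exI[of _ "pt (t 1)"] exI[of _ "pt (t 0)"] conjI refl hull_inc) auto
      moreover have "pt (t 1) - pt (t 0) = g k"
        by (simp add: t_def pt_upd[OF k(1)] algebra_simps)
      ultimately show "x \<in> lin_space (face c)"
        using k by simp
    qed
  qed
  have diff: "x - ?q \<in> span ?G" if x: "x \<in> face c" for x
  proof -
    obtain t where t: "t \<in> cube" "x = pt t"
      using x by (auto simp: face_def Z_def)
    have "x - ?q = (\<Sum>k<m. (t k - centre c k) *\<^sub>R g k)"
      unfolding t(2) pt_def by (simp add: sum_subtractf[symmetric] algebra_simps)
    also have "\<dots> \<in> span ?G"
    proof (rule span_sum)
      fix k assume "k \<in> {..<m}"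
      then have k: "k < m" by simp
      show "(t k - centre c k) *\<^sub>R g k \<in> span ?G"
      proof (cases "c \<bullet> g k = 0")
        case True
        then show ?thesis
          using k by (intro span_scale span_base) blast
      next
        case False
        then have "t k = centre c k"
          using x k unfolding t(2) pt_mem_face_iff[OF t(1)] centre_def by auto
        then show ?thesis
          by (simp add: span_zero)
      qed
    qed
    finally show ?thesis .
  qed
  have "affine hull face c \<subseteq> {x. x - ?q \<in> span ?G}"
  proof (rule hull_minimal)
    have "affine ((+) ?q ` span ?G)"
      by (simp add: affine_translation[symmetric] subspace_imp_affine)
    moreover have "(+) ?q ` span ?G = {x. x - ?q \<in> span ?G}"
      by (force simp: image_iff algebra_simps)
    ultimately show "affine {x. x - ?q \<in> span ?G}"
      by simp
  qed (use diff in blast)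
  then show "lin_space (face c) \<subseteq> span ?G"
    unfolding lin_space_def
  proof safe
    fix x y assume "affine hull face c \<subseteq> {x. x - ?q \<in> span ?G}" "x \<in> affine hull face c" "y \<in> affine hull face c"
    then have "(x - ?q) - (y - ?q) \<in> span ?G"
      by (intro span_diff[of "x - ?q" _ "y - ?q"]) auto
    then show "x - y \<in> span ?G" by simp
  qed
qed

lemma lin_space_Z: "lin_space Z = span (g ` {..<m})"
proof -
  have "{g k | k. k < m \<and> 0 \<bullet> g k = 0} = g ` {..<m}"
    by auto
  then show ?thesis
    using lin_space_face[of 0] by (simp add: face_0)
qed

section \<open>Normal cones, tangent cones and cells\<close>

lemma normal_cone_face: "normal_cone (face c) Z = {c'. face c \<subseteq> face c'}"
  using face_subset_Z by (auto simp: normal_cone_def face_def)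

lemma mem_orthogonal_comp_lin_space_face:
  "c' \<in> (lin_space (face c))\<^sup>\<bottom> \<longleftrightarrow> (\<forall>k<m. c \<bullet> g k = 0 \<longrightarrow> c' \<bullet> g k = 0)"
  unfolding lin_space_face orthogonal_comp_span by (auto simp: inner_commute)

text \<open>The normal cone is the polar of the tangent cone, and its points are limits of points of
  the cell, so testing on the cell is enough.\<close>

lemma mem_tangent_cone_face:
  "x \<in> tangent_cone (face c) Z \<longleftrightarrow> (\<forall>c'. face c' = face c \<longrightarrow> x \<bullet> c' \<le> 0)"
proof
  assume "x \<in> tangent_cone (face c) Z"
  then show "\<forall>c'. face c' = face c \<longrightarrow> x \<bullet> c' \<le> 0"
    unfolding tangent_cone_polar_normal_cone[OF polytope_Z face_of_Z face_nonempty]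
      normal_cone_face by (auto simp: inner_commute)
next
  assume R: "\<forall>c'. face c' = face c \<longrightarrow> x \<bullet> c' \<le> 0"
  have "c' \<bullet> x \<le> 0" if c': "face c \<subseteq> face c'" for c'
  proof (rule field_le_epsilon)
    fix e :: real assume "e > 0"
    \<comment> \<open>\<open>c' + d *\<^sub>R c\<close> lies in the cell of \<open>c\<close> for
      every positive \<open>d\<close>; this \<open>d\<close> keeps the error
      \<open>d * \<bar>x \<bullet> c\<bar>\<close> below \<open>e\<close>.\<close>
    define d where "d = e / (\<bar>x \<bullet> c\<bar> + 1)"
    have d: "d > 0" using \<open>e > 0\<close> by (simp add: d_def add_nonneg_pos)
    have "(c' + d *\<^sub>R c) \<bullet> g k > 0 \<longleftrightarrow> c \<bullet> g k > 0" "(c' + d *\<^sub>R c) \<bullet> g k < 0 \<longleftrightarrow> c \<bullet> g k < 0"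
      if "k < m" for k
    proof -
      have s: "(c' \<bullet> g k > 0 \<longrightarrow> c \<bullet> g k > 0) \<and> (c' \<bullet> g k < 0 \<longrightarrow> c \<bullet> g k < 0)"
        using c' that unfolding face_subset_iff by blast
      have "d * (c \<bullet> g k) > 0 \<longleftrightarrow> c \<bullet> g k > 0" "d * (c \<bullet> g k) < 0 \<longleftrightarrow> c \<bullet> g k < 0"
        using d by (auto simp: zero_less_mult_iff mult_less_0_iff)
      with s show "(c' + d *\<^sub>R c) \<bullet> g k > 0 \<longleftrightarrow> c \<bullet> g k > 0" "(c' + d *\<^sub>R c) \<bullet> g k < 0 \<longleftrightarrow> c \<bullet> g k < 0"
        unfolding inner_add_left inner_scaleR_left by linarith+
    qed
    then have "face (c' + d *\<^sub>R c) = face c"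
      by (intro subset_antisym) (auto simp: face_subset_iff)
    then have "x \<bullet> (c' + d *\<^sub>R c) \<le> 0"
      using R by blast
    then have "c' \<bullet> x \<le> - (d * (x \<bullet> c))"
      by (simp add: inner_add_right inner_commute)
    also have "\<dots> \<le> d * \<bar>x \<bullet> c\<bar>"
      using d by (metis abs_ge_minus_self mult_le_cancel_left_pos mult_minus_right)
    also have "\<dots> \<le> d * (\<bar>x \<bullet> c\<bar> + 1)"
      using d by simp
    also have "\<dots> = e"
      by (simp add: d_def add_nonneg_pos less_imp_neq[symmetric])
    finally show "c' \<bullet> x \<le> 0 + e" by simp
  qed
  then show "x \<in> tangent_cone (face c) Z"
    unfolding tangent_cone_polar_normal_cone[OF polytope_Z face_of_Z face_nonempty]
      normal_cone_face by blast
qed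

text \<open>The generators orthogonal to \<open>c\<close> give the linear equations of the cell, the
  remaining ones give strict inequalities. Convexity, relative openness and dimension of the cell
  all follow.\<close>

lemma cell_eq_Int_open:
  obtains T where "open T" "convex T" "{c'. face c' = face c} = (lin_space (face c))\<^sup>\<bottom> \<inter> T"
proof -
  define T where "T = (\<Inter>k\<in>{k. k < m \<and> c \<bullet> g k \<noteq> 0}. {c'. 0 < (sgn (c \<bullet> g k) *\<^sub>R g k) \<bullet> c'})"
  have "finite {k. k < m \<and> c \<bullet> g k \<noteq> 0}"
    by simp
  then have "open T"
    unfolding T_def by (intro open_INT ballI open_halfspace_gt)
  moreover have "convex T"
    unfolding T_def by (intro convex_INT convex_halfspace_gt)
  moreover have "{c'. face c' = face c} = (lin_space (face c))\<^sup>\<bottom> \<inter> T"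
  proof -
    have "sgn r = sgn s \<longleftrightarrow> (s = 0 \<longrightarrow> r = 0) \<and> (s \<noteq> 0 \<longrightarrow> 0 < sgn s * r)" for r s :: real
      by (auto simp: sgn_real_def)
    then show ?thesis
      by (auto simp: face_eq_iff mem_orthogonal_comp_lin_space_face T_def inner_commute)
  qed
  ultimately show thesis
    by (rule that)
qed

lemma convex_cell: "convex {c'. face c' = face c}"
  and rel_open_cell: "rel_open {c'. face c' = face c}"
  and aff_dim_cell: "aff_dim {c'. face c' = face c} = int (DIM('a) - dim (lin_space (face c)))"
proof -
  let ?L = "(lin_space (face c))\<^sup>\<bottom>"
  obtain T where T: "open T" "convex T" and eq: "{c'. face c' = face c} = ?L \<inter> T"
    by (rule cell_eq_Int_open)
  have L: "subspace ?L" by (rule subspace_orthogonal_comp)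
  then have aff: "affine ?L" "convex ?L"
    by (auto intro: subspace_imp_affine subspace_imp_convex)
  show "convex {c'. face c' = face c}"
    unfolding eq using aff T by (simp add: convex_Int)
  show "rel_open {c'. face c' = face c}"
    unfolding eq using aff T by (intro rel_open_Int_open affine_rel_open)
  have "?L \<inter> T \<noteq> {}"
    using eq by blast
  then have "aff_dim (?L \<inter> T) = aff_dim ?L"
    by (rule aff_dim_convex_Int_open[OF aff(2) T(1)])
  also have "\<dots> = int (DIM('a) - dim (lin_space (face c)))"
    using L by (simp add: aff_dim_subspace dim_orthogonal_comp lin_space_parallel(1)[OF face_nonempty])
  finally show "aff_dim {c'. face c' = face c} = int (DIM('a) - dim (lin_space (face c)))"
    unfolding eq .
qed

lemma euler_sign_cell:
  "euler_sign {c'. face c' = face c} = (-1) ^ (DIM('a) - dim (lin_space (face c)))"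
  unfolding euler_sign_def aff_dim_cell by auto

section \<open>Angle sums over a flat\<close>

lemma flats_Z: "flats Z = lin_space ` range face"
  unfolding flats_def using face_of_Z_iff by blast

lemma finite_flats: "finite (flats Z)"
  unfolding flats_Z using finite_range_face by simp

lemma subspace_lin_space_face: "subspace (lin_space (face c))"
  by (rule lin_space_parallel(1)[OF face_nonempty])

lemma subspace_flat: "U \<in> flats Z \<Longrightarrow> subspace U"
  by (auto simp: flats_Z subspace_lin_space_face)

lemma generator_mem_lin_space_face: "k < m \<Longrightarrow> g k \<in> lin_space (face c) \<longleftrightarrow> c \<bullet> g k = 0"
proof
  assume "k < m" "g k \<in> lin_space (face c)"
  moreover have "c \<in> (lin_space (face c))\<^sup>\<bottom>"
    by (simp add: mem_orthogonal_comp_lin_space_face)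
  ultimately show "c \<bullet> g k = 0"
    by (auto simp: orthogonal_comp_def orthogonal_def inner_commute)
qed (auto simp: lin_space_face intro: span_base)

text \<open>A generator lies in \<open>lin_space (face c)\<close> iff it is orthogonal to
  \<open>c\<close>, so the spanning set can be named from \<open>U\<close> without choosing a
  face.\<close>

lemma flat_eq_span:
  assumes "U \<in> flats Z"
  shows "U = span {g k | k. k < m \<and> g k \<in> U}"
proof -
  obtain c where c: "U = lin_space (face c)"
    using assms by (auto simp: flats_Z)
  have "{g k | k. k < m \<and> c \<bullet> g k = 0} = {g k | k. k < m \<and> g k \<in> U}"
    unfolding c using generator_mem_lin_space_face by blast
  then show ?thesis
    using c lin_space_face by simp
qed

text \<open>In other words, \<open>U\<^sup>\<bottom>\<close> is the union of the cells of the faces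
  whose flat contains \<open>U\<close>.\<close>

lemma mem_orthogonal_comp_flat_iff:
  assumes U: "U \<in> flats Z"
  shows "c \<in> U\<^sup>\<bottom> \<longleftrightarrow> U \<subseteq> lin_space (face c)"
proof
  assume c: "c \<in> U\<^sup>\<bottom>"
  have "c \<bullet> g k = 0" if "g k \<in> U" for k
    using c that by (auto simp: orthogonal_comp_def orthogonal_def inner_commute)
  then have "span {g k | k. k < m \<and> g k \<in> U} \<subseteq> lin_space (face c)"
    unfolding lin_space_face by (intro span_mono) blast
  then show "U \<subseteq> lin_space (face c)"
    using flat_eq_span[OF U] by simp
next
  assume "U \<subseteq> lin_space (face c)"
  moreover have "c \<in> (lin_space (face c))\<^sup>\<bottom>"
    by (simp add: mem_orthogonal_comp_lin_space_face)
  ultimately show "c \<in> U\<^sup>\<bottom>"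
    by (auto simp: orthogonal_comp_def)
qed

text \<open>By self-adjointness \<open>\<pi> x \<bullet> g k = \<pi> (g k) \<bullet> x\<close>, and
  a generic \<open>x\<close> makes this vanish only if \<open>\<pi> (g k) = 0\<close>.\<close>

lemma projection_generic:
  assumes W: "subspace W" and \<pi>: "\<And>x. \<pi> x \<in> W\<^sup>\<bottom>" "\<And>x. x - \<pi> x \<in> W"
    and x: "\<forall>b\<in>(\<pi> ` g ` {..<m}) - {0}. b \<bullet> x \<noteq> 0" and k: "k < m"
  shows "\<pi> x \<bullet> g k = 0 \<longleftrightarrow> g k \<in> W"
proof -
  have "\<pi> x \<bullet> g k = \<pi> (g k) \<bullet> x"
    using orthogonal_projection_self_adjoint[OF \<pi>] by (metis inner_commute)
  also have "\<dots> = 0 \<longleftrightarrow> \<pi> (g k) = 0"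
    using x k by auto
  also have "\<dots> \<longleftrightarrow> g k \<in> W"
    by (rule orthogonal_projection_eq_0_iff[OF W \<pi>])
  finally show ?thesis .
qed

text \<open>A generic vector of the orthogonal complement is orthogonal to no generators besides
  those in \<open>span B\<close>, so its face has this flat.\<close>

lemma span_in_flats:
  assumes B: "B \<subseteq> g ` {..<m}"
  shows "span B \<in> flats Z"
proof -
  obtain \<pi> where \<pi>: "\<And>x. \<pi> x \<in> (span B)\<^sup>\<bottom>" "\<And>x. x - \<pi> x \<in> span B"
    using subspace_orthogonal_decomp[OF subspace_span] by blast
  obtain x where x: "\<forall>b\<in>(\<pi> ` g ` {..<m}) - {0}. b \<bullet> x \<noteq> 0"
    using open_avoids_hyperplanes[of UNIV "(\<pi> ` g ` {..<m}) - {0}"] by auto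
  have "{g k | k. k < m \<and> \<pi> x \<bullet> g k = 0} = {g k | k. k < m \<and> g k \<in> span B}"
    using projection_generic[OF subspace_span \<pi> x] by blast
  moreover have "span {g k | k. k < m \<and> g k \<in> span B} = span B"
  proof
    show "span {g k | k. k < m \<and> g k \<in> span B} \<subseteq> span B"
      by (intro span_minimal) auto
    show "span B \<subseteq> span {g k | k. k < m \<and> g k \<in> span B}"
      using B by (intro span_mono) (auto intro: span_base)
  qed
  ultimately have "span B = lin_space (face (\<pi> x))"
    by (simp add: lin_space_face)
  then show ?thesis
    by (auto simp: flats_Z)
qed

section \<open>Exterior angles over a flat\<close>

lemma exterior_cone_eq:
  assumes U: "lin_space (face c) = U" and \<pi>: "\<And>x. \<pi> x \<in> U\<^sup>\<bottom>" "\<And>x. x - \<pi> x \<in> U"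
  shows "x \<in> normal_cone (face c) Z + U \<longleftrightarrow> face c \<subseteq> face (\<pi> x)"
proof
  assume "x \<in> normal_cone (face c) Z + U"
  then obtain n u where x: "x = n + u" and n: "face c \<subseteq> face n" and u: "u \<in> U"
    by (auto simp: set_plus_def normal_cone_face)
  \<comment> \<open>The normal cone lies in \<open>U\<^sup>\<bottom>\<close>, so \<open>n\<close>
    must be the component \<open>\<pi> x\<close> of \<open>x\<close>.\<close>
  have "n \<in> U\<^sup>\<bottom>"
    using n unfolding U[symmetric] mem_orthogonal_comp_lin_space_face face_subset_iff
    by (metis less_irrefl linorder_neqE_linordered_idom)
  have sub: "subspace U"
    using U subspace_lin_space_face by blast
  have "(x - \<pi> x) - u \<in> U"
    by (rule subspace_diff[OF sub \<pi>(2) u])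
  moreover have "n - \<pi> x \<in> U\<^sup>\<bottom>"
    by (rule subspace_diff[OF subspace_orthogonal_comp \<open>n \<in> U\<^sup>\<bottom>\<close> \<pi>(1)])
  moreover have "(x - \<pi> x) - u = n - \<pi> x"
    using x by simp
  ultimately have "(n - \<pi> x) \<bullet> (n - \<pi> x) = 0"
    by (auto simp: orthogonal_comp_def orthogonal_def)
  then have "n = \<pi> x" by simp
  with n show "face c \<subseteq> face (\<pi> x)" by simp
next
  assume "face c \<subseteq> face (\<pi> x)"
  then have "\<pi> x + (x - \<pi> x) \<in> normal_cone (face c) Z + U"
    using \<pi>(2) by (intro set_plus_intro) (auto simp: normal_cone_face)
  then show "x \<in> normal_cone (face c) Z + U" by simp
qed

lemma polyhedral_cone_exterior_cone:
  "polyhedral_cone (normal_cone (face c) Z + lin_space (face c))"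
proof -
  let ?U = "lin_space (face c)"
  obtain \<pi> where \<pi>: "\<And>x. \<pi> x \<in> ?U\<^sup>\<bottom>" "\<And>x. x - \<pi> x \<in> ?U"
    using subspace_orthogonal_decomp[OF subspace_lin_space_face] by blast
  define H where "H k = (if c \<bullet> g k > 0 then UNIV else {x. \<pi> (g k) \<bullet> x \<le> 0})
    \<inter> (if c \<bullet> g k < 0 then UNIV else {x. \<pi> (g k) \<bullet> x \<ge> 0})" for k
  have inner: "\<pi> x \<bullet> g k = \<pi> (g k) \<bullet> x" for x k
    using orthogonal_projection_self_adjoint[OF \<pi>] by (metis inner_commute)
  have H: "x \<in> H k \<longleftrightarrow> (\<pi> (g k) \<bullet> x > 0 \<longrightarrow> c \<bullet> g k > 0) \<and> (\<pi> (g k) \<bullet> x < 0 \<longrightarrow> c \<bullet> g k < 0)" for x k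
    unfolding H_def by (cases "c \<bullet> g k > 0"; cases "c \<bullet> g k < 0") auto
  have "normal_cone (face c) Z + ?U = (\<Inter>k\<in>{..<m}. H k)"
    unfolding set_eq_iff exterior_cone_eq[OF refl \<pi>] face_subset_iff
    by (auto simp: H inner)
  moreover have "polyhedral_cone (H k)" for k
    unfolding H_def
    by (auto intro!: polyhedral_cone_Int polyhedral_cone_UNIV polyhedral_cone_halfspace_le
        polyhedral_cone_halfspace_ge)
  ultimately show ?thesis
    by (simp add: polyhedral_cone_INT)
qed

text \<open>A generic \<open>x\<close> lies in exactly one of the exterior cones with flat
  \<open>U\<close>, namely that of \<open>face (\<pi> x)\<close>.\<close>

lemma exterior_angle_sum_flat:
  assumes \<alpha>: "cone_angle \<alpha>" and U: "U \<in> flats Z"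
  shows "(\<Sum>F\<in>{F \<in> range face. lin_space F = U}. exterior_angle \<alpha> F Z) = 1"
proof -
  let ?I = "{F \<in> range face. lin_space F = U}"
  have sub: "subspace U" using U by (rule subspace_flat)
  obtain \<pi> where \<pi>: "\<And>x. \<pi> x \<in> U\<^sup>\<bottom>" "\<And>x. x - \<pi> x \<in> U"
    using subspace_orthogonal_decomp[OF sub] by blast
  have fin: "finite ?I"
    using finite_range_face by simp
  have "(\<Sum>F\<in>?I. 1 * \<alpha> (normal_cone F Z + lin_space F)) = 1"
  proof (rule cone_angle_indicator_identity[OF \<alpha> fin])
    show "polyhedral_cone (normal_cone F Z + lin_space F)" if "F \<in> ?I" for F
      using that polyhedral_cone_exterior_cone by auto
    show "finite (\<pi> ` g ` {..<m} - {0})" "0 \<notin> \<pi> ` g ` {..<m} - {0}"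
      by auto
    fix x assume x: "\<forall>b\<in>\<pi> ` g ` {..<m} - {0}. b \<bullet> x \<noteq> 0"
    have gen: "\<pi> x \<bullet> g k = 0 \<longleftrightarrow> g k \<in> U" if "k < m" for k
      using projection_generic[OF sub \<pi> x that] .
    have "{g k | k. k < m \<and> \<pi> x \<bullet> g k = 0} = {g k | k. k < m \<and> g k \<in> U}"
      using gen by blast
    then have "lin_space (face (\<pi> x)) = U"
      using flat_eq_span[OF U] by (simp add: lin_space_face)
    then have mem: "face (\<pi> x) \<in> ?I"
      by blast
    have ind: "1 * indicator (normal_cone F Z + lin_space F) x = (if F = face (\<pi> x) then 1 else 0::real)"
      if F: "F \<in> ?I" for F
    proof -
      obtain c where c: "F = face c" "lin_space (face c) = U"
        using F by blast
      \<comment> \<open>Both faces have flat \<open>U\<close>, so \<open>c\<close> and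
        \<open>\<pi> x\<close> vanish on the same generators; then the sign implications can be
        reversed.\<close>
      have "F = face (\<pi> x)" if sub: "face c \<subseteq> face (\<pi> x)"
      proof -
        have "c \<bullet> g k = 0 \<longleftrightarrow> \<pi> x \<bullet> g k = 0" if "k < m" for k
          using generator_mem_lin_space_face[OF that, of c] gen[OF that] c(2) by simp
        then have "face (\<pi> x) \<subseteq> face c"
          using sub unfolding face_subset_iff by (metis less_asym linorder_neqE_linordered_idom less_irrefl)
        with sub show ?thesis
          using c by blast
      qed
      then have "x \<in> normal_cone F Z + lin_space F \<longleftrightarrow> F = face (\<pi> x)"
        using exterior_cone_eq[OF c(2) \<pi>, of x] c by auto
      then show ?thesis
        by (simp add: indicator_def)
    qed
    have "(\<Sum>F\<in>?I. 1 * indicator (normal_cone F Z + lin_space F) x)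
        = (\<Sum>F\<in>?I. if F = face (\<pi> x) then 1 else 0::real)"
      by (rule sum.cong[OF refl ind])
    also have "\<dots> = 1"
      using fin mem by (simp add: sum.delta)
    finally show "(\<Sum>F\<in>?I. 1 * indicator (normal_cone F Z + lin_space F) x) = (1::real)" .
  qed
  then show ?thesis
    by (simp add: exterior_angle_def)
qed

section \<open>Interior angles over a flat\<close>

text \<open>If \<open>x\<close> is in the tangent cone, the positive part of the cell is empty and
  the left side is the sign of the whole cell. Otherwise the positive part is a nonempty open piece
  with the sign of the cell, so the rest sums to 0.\<close>

lemma euler_sign_halfspace_part_of_cell:
  "euler_sign ({c'. face c' = face c} \<inter> {y. x \<bullet> y < 0})
    + euler_sign ({c'. face c' = face c} \<inter> {y. x \<bullet> y = 0})
    = (-1) ^ (DIM('a) - dim (lin_space (face c))) * indicator (tangent_cone (face c) Z) x"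
    (is "euler_sign (?\<tau> \<inter> ?L) + euler_sign (?\<tau> \<inter> ?M) = _")
proof -
  let ?R = "{y. x \<bullet> y > 0}"
  have split: "euler_sign ?\<tau> = euler_sign (?\<tau> \<inter> ?L) + euler_sign (?\<tau> \<inter> ?M) + euler_sign (?\<tau> \<inter> ?R)"
    by (rule euler_sign_split[OF rel_open_cell convex_cell])
  show ?thesis
  proof (cases "x \<in> tangent_cone (face c) Z")
    case True
    then have "?\<tau> \<inter> ?R = {}"
      by (auto simp: mem_tangent_cone_face simp flip: not_le)
    then have "euler_sign (?\<tau> \<inter> ?R) = 0"
      by simp
    with split True show ?thesis
      by (simp add: euler_sign_cell)
  next
    case False
    then have ne: "?\<tau> \<inter> ?R \<noteq> {}"
      by (auto simp: mem_tangent_cone_face not_le)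
    then have "aff_dim (?\<tau> \<inter> ?R) = aff_dim ?\<tau>"
      by (intro aff_dim_convex_Int_open convex_cell open_halfspace_gt)
    with ne have "euler_sign (?\<tau> \<inter> ?R) = euler_sign ?\<tau>"
      by (auto simp: euler_sign_def)
    with split False show ?thesis
      by simp
  qed
qed

lemma interior_cone_indicator_sum:
  assumes U: "U \<in> flats Z" and w: "w \<in> U\<^sup>\<bottom>" "w \<bullet> x \<noteq> 0"
  shows "(\<Sum>F\<in>{F \<in> range face. U \<subseteq> lin_space F}.
    (-1) ^ (DIM('a) - dim (lin_space F)) * indicator (tangent_cone F Z) x) = (0::real)"
proof -
  let ?S = "U\<^sup>\<bottom>" and ?L = "{y. x \<bullet> y < 0}" and ?M = "{y. x \<bullet> y = 0}" and ?R = "{y. x \<bullet> y > 0}"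
  have sub: "subspace ?S"
    by (rule subspace_orthogonal_comp)
  then have S: "rel_open ?S" "convex ?S"
    by (auto intro: affine_rel_open subspace_imp_affine subspace_imp_convex)
  \<comment> \<open>\<open>w\<close> and \<open>- w\<close> lie on different sides, so the
    hyperplane orthogonal to \<open>x\<close> properly cuts
    \<open>U\<^sup>\<bottom>\<close>.\<close>
  have "- w \<in> ?S"
    using sub w by (simp add: subspace_neg)
  then have ne: "?S \<inter> ?L \<noteq> {}" "?S \<inter> ?R \<noteq> {}" "?S \<noteq> {}"
    using w by (cases "w \<bullet> x > 0"; force simp: inner_commute)+
  then have "aff_dim (?S \<inter> ?L) = aff_dim ?S" "aff_dim (?S \<inter> ?R) = aff_dim ?S"
    using S by (auto intro!: aff_dim_convex_Int_open open_halfspace_lt open_halfspace_gt)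
  then have "euler_sign (?S \<inter> ?L) = euler_sign ?S" "euler_sign (?S \<inter> ?R) = euler_sign ?S"
    using ne by (auto simp: euler_sign_def)
  then have zero: "euler_sign (?S \<inter> ?L) + euler_sign (?S \<inter> ?M) = 0"
    using euler_sign_split[OF S, of x] by linarith
  have cell: "euler_sign (?S \<inter> T \<inter> {c. face c = F}) =
      (if U \<subseteq> lin_space F then euler_sign ({c. face c = F} \<inter> T) else 0)" for T F
  proof (cases "U \<subseteq> lin_space F")
    case True
    then have "?S \<inter> T \<inter> {c. face c = F} = {c. face c = F} \<inter> T"
      using mem_orthogonal_comp_flat_iff[OF U] by blast
    with True show ?thesis by simp
  next
    case False
    then have "?S \<inter> T \<inter> {c. face c = F} = {}"
      using mem_orthogonal_comp_flat_iff[OF U] by blast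
    with False show ?thesis by simp
  qed
  have fibres: "(\<Sum>F\<in>range face. euler_sign (T \<inter> {c. face c = F})) = euler_sign T"
    if "rel_open T" "convex T" for T
    by (rule euler_sign_sum_fibres[OF _ that face_eq_iff]) simp
  \<comment> \<open>The closed half of \<open>U\<^sup>\<bottom>\<close> is not relatively open, so
    its open part and its boundary slice are distributed over the cells separately.\<close>
  have "0 = (\<Sum>F\<in>range face. euler_sign (?S \<inter> ?L \<inter> {c. face c = F}))
      + (\<Sum>F\<in>range face. euler_sign (?S \<inter> ?M \<inter> {c. face c = F}))"
    using zero fibres[OF rel_open_Int_open[OF S open_halfspace_lt] convex_Int[OF S(2) convex_halfspace_lt]]
      fibres[OF rel_open_Int_hyperplane[OF S] convex_Int[OF S(2) convex_hyperplane]]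
    by (simp only:)
  also have "\<dots> = (\<Sum>F\<in>range face. if U \<subseteq> lin_space F
      then euler_sign ({c. face c = F} \<inter> ?L) + euler_sign ({c. face c = F} \<inter> ?M) else 0)"
    by (subst sum.distrib[symmetric], rule sum.cong[OF refl]) (simp add: cell)
  also have "\<dots> = (\<Sum>F\<in>{F \<in> range face. U \<subseteq> lin_space F}.
      euler_sign ({c. face c = F} \<inter> ?L) + euler_sign ({c. face c = F} \<inter> ?M))"
    by (rule sum.inter_filter[OF finite_range_face, symmetric])
  also have "\<dots> = (\<Sum>F\<in>{F \<in> range face. U \<subseteq> lin_space F}.
      (-1) ^ (DIM('a) - dim (lin_space F)) * indicator (tangent_cone F Z) x)"
    by (rule sum.cong[OF refl]) (auto simp: euler_sign_halfspace_part_of_cell)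
  finally show ?thesis by simp
qed

text \<open>Since \<open>U\<close> is proper, \<open>U\<^sup>\<bottom>\<close> contains some
  \<open>w \<noteq> 0\<close>, and the indicator identity holds off the single hyperplane orthogonal
  to \<open>w\<close>.\<close>

lemma interior_angle_alternating_sum:
  assumes \<alpha>: "cone_angle \<alpha>" and U: "U \<in> flats Z" "U \<noteq> UNIV"
  shows "(\<Sum>F\<in>{F \<in> range face. U \<subseteq> lin_space F}.
    (-1) ^ (DIM('a) - dim (lin_space F)) * interior_angle \<alpha> F Z) = 0"
proof -
  have "U\<^sup>\<bottom> \<noteq> {0}"
    using orthogonal_comp_self[OF subspace_flat[OF U(1)]] U(2) orthogonal_comp_null by metis
  then obtain w where w: "w \<in> U\<^sup>\<bottom>" "w \<noteq> 0"
    using subspace_0[OF subspace_orthogonal_comp, of U] by blast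
  show ?thesis
    unfolding interior_angle_def
  proof (rule cone_angle_indicator_identity[OF \<alpha>])
    show "finite {F \<in> range face. U \<subseteq> lin_space F}"
      using finite_range_face by simp
    show "polyhedral_cone (tangent_cone F Z)" for F
      by (rule polyhedral_cone_tangent_cone[OF polytope_Z])
    show "finite {w}" "0 \<notin> {w}"
      using w by auto
  qed (use interior_cone_indicator_sum[OF U(1) w(1)] in auto)
qed

section \<open>The lattice of flats\<close>

lemma UNIV_in_flats:
  assumes "span (g ` {..<m}) = UNIV"
  shows "UNIV \<in> flats Z"
  using span_in_flats[of "g ` {..<m}"] assms by simp

lemma zero_in_flats: "{0} \<in> flats Z"
  using span_in_flats[of "{}"] by simp

text \<open>As long as \<open>V \<noteq> U\<close>, some generator in \<open>U\<close> is missing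
  from \<open>V\<close>; adjoining it yields a flat one dimension higher.\<close>

lemma flat_chain:
  assumes "V \<in> flats Z" "U \<in> flats Z" "V \<subseteq> U"
  shows "\<exists>C. finite C \<and> C \<subseteq> flats Z \<and> (\<forall>X\<in>C. \<forall>Y\<in>C. X \<subseteq> Y \<or> Y \<subseteq> X) \<and>
    (\<forall>X\<in>C. V \<subseteq> X \<and> X \<subseteq> U) \<and> card C = Suc (dim U - dim V)"
  using assms
proof (induction "dim U - dim V" arbitrary: V)
  case 0
  then have "V = U"
    by (intro subspace_dim_equal) (auto simp: subspace_flat)
  with 0 show ?case
    by (intro exI[of _ "{V}"]) auto
next
  case (Suc n)
  have "V \<noteq> U"
    using Suc.hyps(2) by auto
  have subV: "subspace V"
    using Suc.prems subspace_flat by blast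
  have "\<exists>k<m. g k \<in> U \<and> g k \<notin> V"
  proof (rule ccontr)
    assume "\<not> ?thesis"
    then have "span {g k | k. k < m \<and> g k \<in> U} \<subseteq> V"
      using subV by (intro span_minimal) auto
    then show False
      using flat_eq_span[OF Suc.prems(2)] Suc.prems(3) \<open>V \<noteq> U\<close> by simp
  qed
  then obtain k where k: "k < m" "g k \<in> U" "g k \<notin> V"
    by blast
  define G where "G = {g j | j. j < m \<and> g j \<in> V}"
  define W where "W = span (insert (g k) G)"
  have spG: "span G = V"
    using flat_eq_span[OF Suc.prems(1)] by (simp add: G_def)
  have W: "W \<in> flats Z"
    unfolding W_def using k by (intro span_in_flats) (auto simp: G_def)
  have dimW: "dim W = Suc (dim V)"
    unfolding W_def using k(3) by (metis dim_insert dim_span spG Suc_eq_plus1)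
  have VW: "V \<subseteq> W"
    unfolding W_def spG[symmetric] by (rule span_mono) auto
  have gW: "g k \<in> W"
    unfolding W_def by (rule span_base) auto
  have WU: "W \<subseteq> U"
    unfolding W_def using k(2) Suc.prems
    by (intro span_minimal) (auto simp: G_def subspace_flat)
  have "n = dim U - dim W"
    using Suc.hyps(2) dimW by simp
  from Suc.hyps(1)[OF this W Suc.prems(2) WU]
  obtain C where C: "finite C" "C \<subseteq> flats Z" "\<forall>X\<in>C. \<forall>Y\<in>C. X \<subseteq> Y \<or> Y \<subseteq> X"
    "\<forall>X\<in>C. W \<subseteq> X \<and> X \<subseteq> U" "card C = Suc (dim U - dim W)"
    by (elim exE conjE)
  have "V \<notin> C"
    using C(4) gW k(3) by blast
  then have "card (insert V C) = Suc (dim U - dim V)"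
    using C(1,5) dimW Suc.hyps(2) by simp
  moreover have "V \<subseteq> X" if "X \<in> C" for X
    using C(4) VW that by blast
  ultimately show ?case
    using C Suc.prems by (intro exI[of _ "insert V C"]) simp
qed

lemma lattice_of_flats_iff:
  "(U, V) \<in> lattice_of_flats Z \<longleftrightarrow> U \<in> flats Z \<and> V \<in> flats Z \<and> U \<subseteq> V"
  by (simp add: lattice_of_flats_def)

lemma Field_lattice_of_flats: "Field (lattice_of_flats Z) = flats Z"
  by (auto simp: Field_def lattice_of_flats_def)

lemma Partial_order_lattice_of_flats: "Partial_order (lattice_of_flats Z)"
  unfolding partial_order_on_def preorder_on_def Field_lattice_of_flats
  by (auto simp: refl_on_def trans_def antisym_def lattice_of_flats_def)

lemma poset_rank_flat:
  assumes U: "U \<in> flats Z"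
  shows "poset_rank (lattice_of_flats Z) U = dim U"
proof -
  have "subspace U" using U by (rule subspace_flat)
  then have "{0} \<subseteq> U"
    by (simp add: subspace_0)
  from flat_chain[OF zero_in_flats U this]
  obtain C where C: "C \<subseteq> flats Z" "\<forall>X\<in>C. \<forall>Y\<in>C. X \<subseteq> Y \<or> Y \<subseteq> X"
    "\<forall>X\<in>C. {0} \<subseteq> X \<and> X \<subseteq> U" and card: "card C = Suc (dim U - dim {0::'a})"
    by (elim exE conjE)
  show ?thesis
  proof (rule poset_rank_eq_chain)
    show "finite (Field (lattice_of_flats Z))"
      by (simp add: Field_lattice_of_flats finite_flats)
    show "C \<in> Chains (lattice_of_flats Z)" "C \<subseteq> under (lattice_of_flats Z) U"
      using C U by (auto simp: Chains_def under_def lattice_of_flats_iff)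
    show "card D \<le> Suc (dim U)"
      if D: "D \<in> Chains (lattice_of_flats Z)" "D \<subseteq> under (lattice_of_flats Z) U" for D
    proof -
      have X: "X \<in> flats Z" "X \<subseteq> U" if "X \<in> D" for X
        using D(2) that by (auto simp: under_def lattice_of_flats_iff)
      have "X \<subseteq> Y \<or> Y \<subseteq> X" if "X \<in> D" "Y \<in> D" for X Y
        using D(1) that by (auto simp: Chains_def lattice_of_flats_iff)
      moreover have "dim ` D \<subseteq> {0..dim U}"
      proof (rule image_subsetI)
        fix X assume "X \<in> D"
        then show "dim X \<in> {0..dim U}"
          using dim_subset[OF X(2)] by simp
      qed
      ultimately have "card D \<le> Suc (dim U - 0)"
        using X(1) by (intro card_chain_of_subspaces_le) (auto intro: subspace_flat)
      then show ?thesis by simp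
    qed
    show "card C = Suc (dim U)"
      using card by simp
  qed
qed

text \<open>Below \<open>U\<close> in the opposite order lie the flats containing \<open>U\<close>.
  A longest chain of them climbs one dimension at a time to \<open>UNIV\<close>, which is a flat
  because the generators span.\<close>

lemma poset_rank_flat_converse:
  assumes U: "U \<in> flats Z" and full: "span (g ` {..<m}) = UNIV"
  shows "poset_rank ((lattice_of_flats Z)\<inverse>) U = DIM('a) - dim U"
proof -
  from flat_chain[OF U UNIV_in_flats[OF full] subset_UNIV]
  obtain C where C: "C \<subseteq> flats Z" "\<forall>X\<in>C. \<forall>Y\<in>C. X \<subseteq> Y \<or> Y \<subseteq> X"
    "\<forall>X\<in>C. U \<subseteq> X \<and> X \<subseteq> UNIV" and card: "card C = Suc (dim (UNIV :: 'a set) - dim U)"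
    by (elim exE conjE)
  show ?thesis
  proof (rule poset_rank_eq_chain)
    show "finite (Field ((lattice_of_flats Z)\<inverse>))"
      by (simp add: Field_lattice_of_flats finite_flats)
    show "C \<in> Chains ((lattice_of_flats Z)\<inverse>)" "C \<subseteq> under ((lattice_of_flats Z)\<inverse>) U"
      using C U by (auto simp: Chains_def under_def lattice_of_flats_iff)
    show "card D \<le> Suc (DIM('a) - dim U)"
      if D: "D \<in> Chains ((lattice_of_flats Z)\<inverse>)" "D \<subseteq> under ((lattice_of_flats Z)\<inverse>) U" for D
    proof -
      have X: "X \<in> flats Z" "U \<subseteq> X" if "X \<in> D" for X
        using D(2) that by (auto simp: under_def lattice_of_flats_iff)
      have "X \<subseteq> Y \<or> Y \<subseteq> X" if "X \<in> D" "Y \<in> D" for X Y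
        using D(1) that by (auto simp: Chains_def lattice_of_flats_iff)
      moreover have "dim ` D \<subseteq> {dim U..DIM('a)}"
      proof (rule image_subsetI)
        fix X assume "X \<in> D"
        then show "dim X \<in> {dim U..DIM('a)}"
          using dim_subset[OF X(2)] dim_subset_UNIV[of X] by simp
      qed
      ultimately show ?thesis
        using X(1) by (intro card_chain_of_subspaces_le) (auto intro: subspace_flat)
    qed
    show "card C = Suc (DIM('a) - dim U)"
      using card by simp
  qed
qed

lemma poset_bot_converse:
  assumes "span (g ` {..<m}) = UNIV"
  shows "poset_bot ((lattice_of_flats Z)\<inverse>) = UNIV"
  unfolding poset_bot_def
  by (rule the_equality)
    (use UNIV_in_flats[OF assms] in \<open>auto simp: Field_lattice_of_flats lattice_of_flats_iff\<close>)

lemma faces_of_dim: "{F. F face_of Z \<and> aff_dim F = int i} = {F \<in> range face. dim (lin_space F) = i}"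
proof -
  have "F \<noteq> {}" if "aff_dim F = int i" for F :: "'a set"
    using that by auto
  then have "F face_of Z \<and> aff_dim F = int i \<longleftrightarrow> F \<in> range face \<and> dim (lin_space F) = i" for F
    using face_of_Z_iff[of F] aff_dim_eq_dim_lin_space[of F] by auto
  then show ?thesis by blast
qed

lemma sum_faces_by_flats:
  fixes f :: "'a set \<Rightarrow> real"
  shows "(\<Sum>F\<in>{F \<in> range face. P (lin_space F)}. f F)
    = (\<Sum>U\<in>{U \<in> flats Z. P U}. \<Sum>F\<in>{F \<in> range face. lin_space F = U}. f F)"
proof -
  have "(\<Sum>F\<in>{F \<in> range face. P (lin_space F)}. f F)
    = (\<Sum>U\<in>{U \<in> flats Z. P U}. \<Sum>F\<in>{F \<in> {F \<in> range face. P (lin_space F)}. lin_space F = U}. f F)"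
    by (rule sum.group[symmetric]) (use finite_range_face finite_flats in \<open>auto simp: flats_Z\<close>)
  also have "\<dots> = (\<Sum>U\<in>{U \<in> flats Z. P U}. \<Sum>F\<in>{F \<in> range face. lin_space F = U}. f F)"
    by (intro sum.cong) auto
  finally show ?thesis .
qed

section \<open>Angle sums as Whitney numbers\<close>

lemma exterior_angle_sum_Z:
  assumes "cone_angle \<alpha>"
  shows "exterior_angle_sum \<alpha> i Z = real (whitney_second (lattice_of_flats Z) i)"
proof -
  have "exterior_angle_sum \<alpha> i Z = (\<Sum>U\<in>{U \<in> flats Z. dim U = i}. 1)"
    unfolding exterior_angle_sum_def faces_of_dim sum_faces_by_flats[where P = "\<lambda>U. dim U = i"]
    by (rule sum.cong) (auto simp: exterior_angle_sum_flat[OF assms])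
  also have "{U \<in> flats Z. dim U = i} = {U \<in> Field (lattice_of_flats Z). poset_rank (lattice_of_flats Z) U = i}"
    by (auto simp: Field_lattice_of_flats poset_rank_flat)
  finally show ?thesis
    by (simp add: whitney_second_def)
qed

text \<open>Both sides are 1 at \<open>UNIV\<close> and obey the same recursion over the flats
  strictly above \<open>U\<close>; the induction is on codimension.\<close>

lemma moebius_flat:
  assumes \<alpha>: "cone_angle \<alpha>" and full: "span (g ` {..<m}) = UNIV" and U: "U \<in> flats Z"
  shows "real_of_int (moebius ((lattice_of_flats Z)\<inverse>) UNIV U)
    = (\<Sum>F\<in>{F \<in> range face. lin_space F = U}. (-1) ^ (DIM('a) - dim (lin_space F)) * interior_angle \<alpha> F Z)"
  using U
proof (induction "DIM('a) - dim U" arbitrary: U rule: less_induct)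
  case less
  let ?r = "(lattice_of_flats Z)\<inverse>"
  define h where "h U = (\<Sum>F\<in>{F \<in> range face. lin_space F = U}.
    (-1) ^ (DIM('a) - dim (lin_space F)) * interior_angle \<alpha> F Z)" for U
  have guard: "finite (Field ?r) \<and> Partial_order ?r \<and> (UNIV, U) \<in> ?r"
    using less.prems UNIV_in_flats[OF full] Partial_order_lattice_of_flats finite_flats
    by (simp add: Field_lattice_of_flats lattice_of_flats_iff)
  show ?case
  proof (cases "U = UNIV")
    case True
    \<comment> \<open>\<open>c\<close> is orthogonal to its own flat, so \<open>Z\<close> is the
      only face with flat \<open>UNIV\<close> and its cell is \<open>{0}\<close>.\<close>
    have zero: "c = 0" if "lin_space (face c) = UNIV" for c
    proof -
      have "c \<in> (lin_space (face c))\<^sup>\<bottom>"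
        by (simp add: mem_orthogonal_comp_lin_space_face)
      then show ?thesis
        using that by simp
    qed
    have Z: "lin_space (face 0) = UNIV"
      by (simp add: face_0 lin_space_Z full)
    have "{F \<in> range face. lin_space F = UNIV} = {face 0}"
      using zero Z by blast
    moreover have "tangent_cone (face 0) Z = UNIV"
    proof -
      have "c = 0" if "face c = face 0" for c
        using zero[of c] that Z by simp
      then have "x \<in> tangent_cone (face 0) Z" for x
        unfolding mem_tangent_cone_face by (metis inner_zero_right order_refl)
      then show ?thesis by blast
    qed
    ultimately have "(\<Sum>F\<in>{F \<in> range face. lin_space F = U}.
        (-1) ^ (DIM('a) - dim (lin_space F)) * interior_angle \<alpha> F Z) = 1"
      using \<alpha> True Z by (simp add: interior_angle_def cone_angle_def)
    moreover have "moebius ?r UNIV U = 1"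
      using guard True by (subst moebius.simps) simp
    ultimately show ?thesis by simp
  next
    case False
    let ?S = "{V \<in> flats Z. U \<subset> V}"
    have set: "{V. (UNIV, V) \<in> ?r \<and> (V, U) \<in> ?r \<and> V \<noteq> U} = ?S"
      using less.prems UNIV_in_flats[OF full] by (auto simp: lattice_of_flats_iff)
    have IH: "real_of_int (moebius ?r UNIV V) = h V" if V: "V \<in> ?S" for V
    proof -
      have "dim U < dim V"
        using V less.prems subspace_flat by (metis (no_types, lifting) dim_psubset mem_Collect_eq span_eq_iff)
      moreover have "dim V \<le> DIM('a)"
        by (rule dim_subset_UNIV)
      ultimately show ?thesis
        unfolding h_def using V by (intro less.hyps) auto
    qed
    have "moebius ?r UNIV U = - (\<Sum>V\<in>?S. moebius ?r UNIV V)"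
      using guard False set by (subst moebius.simps) simp
    then have "real_of_int (moebius ?r UNIV U) = - (\<Sum>V\<in>?S. h V)"
      using IH by simp
    also have "\<dots> = h U"
    proof -
      \<comment> \<open>The alternating sum over faces, grouped by flats, becomes the defining
        relation of the Moebius function.\<close>
      have "0 = (\<Sum>V\<in>{V \<in> flats Z. U \<subseteq> V}. h V)"
        unfolding h_def sum_faces_by_flats[where P = "\<lambda>V. U \<subseteq> V", symmetric]
        by (rule interior_angle_alternating_sum[OF \<alpha> less.prems False, symmetric])
      also have "{V \<in> flats Z. U \<subseteq> V} = insert U ?S"
        using less.prems by auto
      also have "(\<Sum>V\<in>insert U ?S. h V) = h U + (\<Sum>V\<in>?S. h V)"
        using finite_flats by (subst sum.insert) auto
      finally show ?thesis by simp
    qed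
    finally show ?thesis
      unfolding h_def .
  qed
qed

lemma interior_angle_sum_Z:
  assumes \<alpha>: "cone_angle \<alpha>" and full: "span (g ` {..<m}) = UNIV" and i: "i \<le> DIM('a)"
  shows "interior_angle_sum \<alpha> i Z =
    (-1) ^ (DIM('a) - i) * real_of_int (whitney_first ((lattice_of_flats Z)\<inverse>) (DIM('a) - i))"
proof -
  let ?r = "(lattice_of_flats Z)\<inverse>"
  have rank: "{U \<in> Field ?r. poset_rank ?r U = DIM('a) - i} = {U \<in> flats Z. dim U = i}"
  proof -
    \<comment> \<open>Here \<open>i \<le> DIM('a)\<close> rules out truncated subtraction, under
      which distinct dimensions could share a codimension.\<close>
    have "poset_rank ?r U = DIM('a) - i \<longleftrightarrow> dim U = i" if "U \<in> flats Z" for U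
      unfolding poset_rank_flat_converse[OF that full]
      using i dim_subset_UNIV[of U] by linarith
    then show ?thesis
      unfolding Field_converse Field_lattice_of_flats by (rule Collect_cong[OF conj_cong[OF refl]])
  qed
  have "real_of_int (whitney_first ?r (DIM('a) - i))
      = (\<Sum>U\<in>{U \<in> flats Z. dim U = i}. real_of_int (moebius ?r UNIV U))"
    unfolding whitney_first_def rank poset_bot_converse[OF full] by simp
  also have "\<dots> = (\<Sum>U\<in>{U \<in> flats Z. dim U = i}. \<Sum>F\<in>{F \<in> range face. lin_space F = U}.
      (-1) ^ (DIM('a) - dim (lin_space F)) * interior_angle \<alpha> F Z)"
    by (rule sum.cong[OF refl]) (auto simp: moebius_flat[OF \<alpha> full])
  also have "\<dots> = (\<Sum>F\<in>{F \<in> range face. dim (lin_space F) = i}.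
      (-1) ^ (DIM('a) - dim (lin_space F)) * interior_angle \<alpha> F Z)"
    by (rule sum_faces_by_flats[where P = "\<lambda>U. dim U = i", symmetric])
  also have "\<dots> = (-1) ^ (DIM('a) - i) * interior_angle_sum \<alpha> i Z"
    unfolding interior_angle_sum_def faces_of_dim sum_distrib_left by (rule sum.cong) auto
  \<comment> \<open>The sign is its own inverse, so it can be moved to the other side.\<close>
  finally show ?thesis
    by (simp flip: mult.assoc power_add)
qed

end

lemma zonotope_as_generators:
  assumes "zonotope S"
  obtains p g m where "S = zonotope_generators.Z p g m"
proof -
  obtain m :: nat and a b where "S = (\<Sum>k<m. closed_segment (a k) (b k))"
    using assms by (auto simp: zonotope_def)
  then have "S = zonotope_generators.Z a (\<lambda>k. b k - a k) m"
    by (simp add: zonotope_generators.Z_eq_sum)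
  then show thesis
    by (rule that)
qed

theorem theorem1p2:
  fixes Z :: "(real ^ 'n) set" and \<alpha> :: "(real ^ 'n) set \<Rightarrow> real"
  assumes "zonotope Z" and "aff_dim Z = int CARD('n)" and "cone_angle \<alpha>"
  shows "\<forall>i<CARD('n).
    exterior_angle_sum \<alpha> i Z = real (whitney_second (lattice_of_flats Z) i) \<and>
    interior_angle_sum \<alpha> i Z =
      (-1) ^ (CARD('n) - i) * real_of_int (whitney_first ((lattice_of_flats Z)\<inverse>) (CARD('n) - i))"
proof -
  obtain p g m where Z: "Z = zonotope_generators.Z p g m"
    using assms(1) by (rule zonotope_as_generators)
  have "Z \<noteq> {}"
    using assms(2) by auto
  then have "dim (lin_space Z) = CARD('n)"
    using aff_dim_eq_dim_lin_space[of Z] assms(2) by simp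
  \<comment> \<open>The flat of \<open>Z\<close> is the span of all generators, so full dimension of
    \<open>Z\<close> means that they span.\<close>
  then have "span (g ` {..<m}) = UNIV"
    unfolding Z zonotope_generators.lin_space_Z
    using dim_eq_full[of "g ` {..<m}"] by simp
  then show ?thesis
    unfolding Z
    using zonotope_generators.exterior_angle_sum_Z[OF assms(3)]
      zonotope_generators.interior_angle_sum_Z[OF assms(3)]
    by simp
qed

end
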